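(* Let $X$ be a compact metric space, $N\ge1$, and let $P_t$, $t\ge0$, be a Markov semigroup on $C(X^N)$ with generator $L$ satisfying conditions (A), (B), (C), (D) listed in the context (with $Y=X^N$). Let $V_0\in C(X^N)$ be a potential and let $V_1,V_2\in C(X^N)$ be separable potentials arising from $v_1,v_2\in C(X)$, that is, $$V_i(x_1,\dots,x_N)=\frac{v_i(x_1)+\dots+v_i(x_N)}{N},\qquad i=1,2.$$ Assume $V_0+V_1$ and $V_0+V_2$ are smooth. Let $\mu_1,\mu_2\in M(X^N)$ be symmetric equilibrium measures for $V_0+V_1$ and $V_0+V_2$ respectively, and let $\rho_1,\rho_2\in M(X)$ denote their $1$-particle marginals. Then $\rho_1=\rho_2$ implies $v_1-v_2$ is constant.
   Context: Write $Y=X^N$, a compact metric space. $C(Y)$ is the space of real continuous functions on $Y$ with the sup norm $\|\cdot\|$; $B(Y)$ is the space of bounded Borel functions; $M(Y)$ is the space of Borel probability measures; $\mu(f)=\int f\,d\mu$. A Markov semigroup on $C(Y)$ is a semigroup $P_t$, $t\ge0$, of bounded operators on $C(Y)$ with $P_tf\ge0$ for $f\ge0$, $\|P_tf-f\|\to0$ as $t\to0+$ for all $f\in C(Y)$, and $P_t1=1$. Its generator is $Lf=\lim_{t\to0+}\frac1t(P_tf-f)$ (limit in $C(Y)$), defined on the dense domain $\mathcal D\subset C(Y)$ where the limit exists. $\mathcal D^+$ is the set of strictly positive functions in $\mathcal D$. For $V\in C(Y)$, the Schrodinger semigroup $P_t^V$, $t\ge0$, on $C(Y)$ is the strongly continuous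 positive semigroup generated by $L+V$; equivalently $u(t)=P_t^Vf$ is the unique solution of $u(t)=P_tf+\int_0^tP_{t-s}Vu(s)\,ds$, $t\ge0$, for $f\in C(Y)$. By positivity $P_t^Vf(x)=\int_Y p^V(t,x,dy)f(y)$ for a family of bounded positive measures $p^V(t,x,\cdot)$, and this formula defines $P_t^Vf$ for $f\in B(Y)$. The principal eigenvalue is $\lambda_V=\lim_{t\to\infty}\frac1t\log\|P_t^V\|$; it is given by the Donsker-Varadhan formula $\lambda_V=\sup_{\mu\in M(Y)}\left(\int_YV\,d\mu-I(\mu)\right)$, where $I(\mu)=-\inf_{u\in\mathcal D^+}\int_Y\frac{Lu}{u}\,d\mu$. An equilibrium measure for $V$ is a $\mu\in M(Y)$ with $\lambda_V=\mu(V)-I(\mu)$. A core for $P_t$, $t\ge0$, is a subspace $\mathcal D^\infty\subset\mathcal D$ whose closure in the graph norm $\|f\|+\|Lf\|$ equals $\mathcal D$. The conditions are: (A) There are $T>0$ and $\epsilon=\epsilon(T)>0$ such that $P_T|f|(x)\ge\epsilon P_T|f|(y)$ for all $x,y\in Y$ and $f\in C(Y)$. (B) There is a $T>0$ such that for every $f\in C(Y)$ with $f\ge0$ and $f\not\equiv0$, $P_Tf>0$ everywhere in $Y$. (C) There is a core $\mathcal D^\infty$ that is closed under multiplication and division: if $f,g\in\mathcal D^\infty$ then $fg\in\mathcal D^\infty$, and if moreover $g>0$, then $f/g\in\mathcal D^\infty$. (D) For the core $\mathcal D^\infty$ of (C), with $\Gamma(g)=L(g^2)-2gLg$ for $g\in\mathcal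 D^\infty$: if $g\in\mathcal D^\infty$ and $\Gamma(g)\equiv0$, then $g$ is a constant. A potential $V\in C(Y)$ is smooth if $P_t^V$ maps $B(Y)$ into $\mathcal D^\infty$ for every $t>0$, with $\mathcal D^\infty$ the core of (C). For a permutation $\sigma$ of $(1,\dots,N)$ and $f\in C(X^N)$, $f^\sigma(x_1,\dots,x_N)=f(x_{\sigma1},\dots,x_{\sigma N})$; for a measure $\mu$ on $X^N$, $\mu^\sigma(f)=\mu(f^\sigma)$; $\mu$ is symmetric if $\mu^\sigma=\mu$ for all permutations $\sigma$. The $1$-particle marginal $\rho\in M(X)$ of $\mu\in M(X^N)$ is given by $\int_Xf\,d\rho=\int_{X^N}f(x_1)\,d\mu(x_1,\dots,x_N)$. *)

theory Defs
  imports "HOL-Analysis.Analysis" "HOL-Probability.Probability_Measure"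
    "HOL-Combinatorics.Permutations"
begin

text \<open>
  Throughout, \<open>Y\<close> is a type whose universe is compact, and \<open>C(Y)\<close> is the Banach space
  \<open>'y \<Rightarrow>\<^sub>C real\<close> of bounded continuous functions with the sup norm; boundedness is automatic by
  compactness. In particular the functions passed to \<open>Bcontfun\<close> below lie in \<open>bcontfun\<close>
  (for quotients, whenever the denominator has no zero).
\<close>

lemma apply_Bcontfun_compact:
  fixes f :: "'y::metric_space \<Rightarrow> real"
  assumes "compact (UNIV :: 'y set)" and "continuous_on UNIV f"
  shows "apply_bcontfun (Bcontfun f) = f"
  using assms by (simp add: Bcontfun_inverse bcontfun_def compact_continuous_image compact_imp_bounded)

definition abs_C :: "('y::metric_space \<Rightarrow>\<^sub>C real) \<Rightarrow> ('y \<Rightarrow>\<^sub>C real)" where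
  "abs_C f = Bcontfun (\<lambda>y. \<bar>f y\<bar>)"

definition mult_C :: "('y::metric_space \<Rightarrow>\<^sub>C real) \<Rightarrow> ('y \<Rightarrow>\<^sub>C real) \<Rightarrow> ('y \<Rightarrow>\<^sub>C real)" where
  "mult_C f g = Bcontfun (\<lambda>y. f y * g y)"

definition div_C :: "('y::metric_space \<Rightarrow>\<^sub>C real) \<Rightarrow> ('y \<Rightarrow>\<^sub>C real) \<Rightarrow> ('y \<Rightarrow>\<^sub>C real)" where
  "div_C f g = Bcontfun (\<lambda>y. f y / g y)"

text \<open>Families of operators are indexed by all reals; only the values at \<open>t \<ge> 0\<close> matter.\<close>

type_synonym 'y family = "real \<Rightarrow> ('y \<Rightarrow>\<^sub>C real) \<Rightarrow>\<^sub>L ('y \<Rightarrow>\<^sub>C real)"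

definition strongly_continuous_semigroup :: "'y::metric_space family \<Rightarrow> bool" where
  "strongly_continuous_semigroup P \<longleftrightarrow>
     P 0 = id_blinfun \<and>
     (\<forall>s\<ge>0. \<forall>t\<ge>0. P (s + t) = P s o\<^sub>L P t) \<and>
     (\<forall>f. ((\<lambda>t. norm (P t f - f)) \<longlongrightarrow> 0) (at_right 0))"

definition positive_family :: "'y::metric_space family \<Rightarrow> bool" where
  "positive_family P \<longleftrightarrow> (\<forall>t\<ge>0. \<forall>f. (\<forall>y. 0 \<le> apply_bcontfun f y) \<longrightarrow> (\<forall>y. 0 \<le> P t f y))"

definition markov_semigroup :: "'y::metric_space family \<Rightarrow> bool" where
  "markov_semigroup P \<longleftrightarrow>
     strongly_continuous_semigroup P \<and> positive_family P \<and>
     (\<forall>t\<ge>0. P t (const_bcontfun 1) = const_bcontfun 1)"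

definition gen_dom :: "'y::metric_space family \<Rightarrow> ('y \<Rightarrow>\<^sub>C real) set" where
  "gen_dom P = {f. \<exists>g. ((\<lambda>t. (1 / t) *\<^sub>R (P t f - f)) \<longlongrightarrow> g) (at_right 0)}"

text \<open>The value of \<open>gen P f\<close> is meaningful only for \<open>f \<in> gen_dom P\<close>.\<close>

definition gen :: "'y::metric_space family \<Rightarrow> ('y \<Rightarrow>\<^sub>C real) \<Rightarrow> ('y \<Rightarrow>\<^sub>C real)" where
  "gen P f = Lim (at_right 0) (\<lambda>t. (1 / t) *\<^sub>R (P t f - f))"

definition gen_dom_pos :: "'y::metric_space family \<Rightarrow> ('y \<Rightarrow>\<^sub>C real) set" where
  "gen_dom_pos P = {u \<in> gen_dom P. \<forall>y. 0 < apply_bcontfun u y}"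

definition is_schrodinger ::
  "'y::metric_space family \<Rightarrow> ('y \<Rightarrow>\<^sub>C real) \<Rightarrow> 'y family \<Rightarrow> bool" where
  "is_schrodinger P V Q \<longleftrightarrow>
     strongly_continuous_semigroup Q \<and> positive_family Q \<and>
     gen_dom Q = gen_dom P \<and> (\<forall>f\<in>gen_dom P. gen Q f = gen P f + mult_C V f)"

text \<open>
  For a Markov semigroup \<open>P\<close> such a family exists (bounded perturbation of the generator), and its
  values at \<open>t \<ge> 0\<close> are unique, so the choice below affects only the irrelevant values at \<open>t < 0\<close>.
\<close>

definition schrodinger :: "'y::metric_space family \<Rightarrow> ('y \<Rightarrow>\<^sub>C real) \<Rightarrow> 'y family" where
  "schrodinger P V = (SOME Q. is_schrodinger P V Q)"

definition represents ::
  "('y::metric_space \<Rightarrow> 'y measure) \<Rightarrow> (('y \<Rightarrow>\<^sub>C real) \<Rightarrow>\<^sub>L ('y \<Rightarrow>\<^sub>C real)) \<Rightarrow> bool" where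
  "represents p A \<longleftrightarrow>
     (\<forall>x. sets (p x) = sets borel \<and> finite_measure (p x)) \<and>
     (\<forall>f x. A f x = (\<integral>y. apply_bcontfun f y \<partial>p x))"

definition bounded_borel :: "('y::metric_space \<Rightarrow> real) set" where
  "bounded_borel = {f. f \<in> borel_measurable borel \<and> bounded (range f)}"

text \<open>
  The kernel \<open>p\<close> of \<open>schrodinger P V t\<close> exists and is unique by the Riesz representation theorem;
  the integral below is the extension of the operator to bounded Borel functions.
\<close>

definition smooth_potential ::
  "'y::metric_space family \<Rightarrow> ('y \<Rightarrow>\<^sub>C real) set \<Rightarrow> ('y \<Rightarrow>\<^sub>C real) \<Rightarrow> bool" where
  "smooth_potential P Dinf V \<longleftrightarrow>
     (\<forall>t>0. \<exists>p. represents p (schrodinger P V t) \<and>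
        (\<forall>f\<in>bounded_borel. \<exists>g\<in>Dinf. \<forall>x. g x = (\<integral>y. f y \<partial>p x)))"

definition principal_eigenvalue :: "'y::metric_space family \<Rightarrow> ('y \<Rightarrow>\<^sub>C real) \<Rightarrow> real" where
  "principal_eigenvalue P V = Lim at_top (\<lambda>t. (1 / t) * ln (norm (schrodinger P V t)))"

definition prob_measures :: "'y::metric_space measure set" where
  "prob_measures = {\<mu>. sets \<mu> = sets borel \<and> prob_space \<mu>}"

definition rate_function :: "'y::metric_space family \<Rightarrow> 'y measure \<Rightarrow> ereal" where
  "rate_function P \<mu> = - (INF u\<in>gen_dom_pos P. ereal (\<integral>y. gen P u y / u y \<partial>\<mu>))"

definition equilibrium_measure ::
  "'y::metric_space family \<Rightarrow> ('y \<Rightarrow>\<^sub>C real) \<Rightarrow> 'y measure \<Rightarrow> bool" where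
  "equilibrium_measure P V \<mu> \<longleftrightarrow>
     \<mu> \<in> prob_measures \<and>
     ereal (principal_eigenvalue P V) = ereal (\<integral>y. V y \<partial>\<mu>) - rate_function P \<mu>"

text \<open>The last conjunct says that the closure of \<open>Dinf\<close> in the graph norm is \<open>gen_dom P\<close>.\<close>

definition is_core :: "'y::metric_space family \<Rightarrow> ('y \<Rightarrow>\<^sub>C real) set \<Rightarrow> bool" where
  "is_core P Dinf \<longleftrightarrow>
     subspace Dinf \<and> Dinf \<subseteq> gen_dom P \<and>
     (\<forall>f\<in>gen_dom P. \<forall>e>0. \<exists>g\<in>Dinf. norm (f - g) + norm (gen P (f - g)) < e)"

definition carre_du_champ :: "'y::metric_space family \<Rightarrow> ('y \<Rightarrow>\<^sub>C real) \<Rightarrow> ('y \<Rightarrow>\<^sub>C real)" where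
  "carre_du_champ P g = gen P (mult_C g g) - 2 *\<^sub>R mult_C g (gen P g)"

definition condition_A :: "'y::metric_space family \<Rightarrow> bool" where
  "condition_A P \<longleftrightarrow>
     (\<exists>T>0. \<exists>\<epsilon>>0. \<forall>x y f. P T (abs_C f) x \<ge> \<epsilon> * P T (abs_C f) y)"

definition condition_B :: "'y::metric_space family \<Rightarrow> bool" where
  "condition_B P \<longleftrightarrow>
     (\<exists>T>0. \<forall>f. (\<forall>y. 0 \<le> apply_bcontfun f y) \<and> f \<noteq> 0 \<longrightarrow> (\<forall>y. 0 < P T f y))"

definition condition_C :: "'y::metric_space family \<Rightarrow> ('y \<Rightarrow>\<^sub>C real) set \<Rightarrow> bool" where
  "condition_C P Dinf \<longleftrightarrow>
     is_core P Dinf \<and>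
     (\<forall>f\<in>Dinf. \<forall>g\<in>Dinf. mult_C f g \<in> Dinf \<and> ((\<forall>y. 0 < g y) \<longrightarrow> div_C f g \<in> Dinf))"

definition condition_D :: "'y::metric_space family \<Rightarrow> ('y \<Rightarrow>\<^sub>C real) set \<Rightarrow> bool" where
  "condition_D P Dinf \<longleftrightarrow>
     (\<forall>g\<in>Dinf. carre_du_champ P g = 0 \<longrightarrow> (\<exists>c. \<forall>y. g y = c))"

text \<open>From here on \<open>Y = X^N\<close> is \<open>'a ^ 'n\<close> with \<open>N = CARD('n)\<close>.\<close>

definition separable_potential :: "('a::metric_space \<Rightarrow>\<^sub>C real) \<Rightarrow> (('a ^ 'n) \<Rightarrow>\<^sub>C real)" where
  "separable_potential v = Bcontfun (\<lambda>x. (\<Sum>i\<in>UNIV. v (x $ i)) / real CARD('n))"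

text \<open>
  The push-forward below is the measure \<open>\<mu>\<^sup>\<sigma>\<close> with \<open>\<mu>\<^sup>\<sigma>(f) = \<mu>(f\<^sup>\<sigma>)\<close>, where
  \<open>f\<^sup>\<sigma>(x) = f (\<chi> i. x $ \<sigma> i)\<close>.
\<close>

definition symmetric_measure :: "('a::metric_space ^ 'n) measure \<Rightarrow> bool" where
  "symmetric_measure \<mu> \<longleftrightarrow>
     (\<forall>\<sigma>. \<sigma> permutes UNIV \<longrightarrow> distr \<mu> borel (\<lambda>x. \<chi> i. x $ \<sigma> i) = \<mu>)"

text \<open>
  The index type has no distinguished element, so the coordinate playing the role of \<open>x\<^sub>1\<close> is the
  parameter \<open>k\<close>; for symmetric \<open>\<mu>\<close> the marginal does not depend on it.
\<close>

definition marginal :: "'n \<Rightarrow> ('a::metric_space ^ 'n) measure \<Rightarrow> 'a measure" where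
  "marginal k \<mu> = distr \<mu> borel (\<lambda>x. x $ k)"

end

theory Submission
  imports Defs
begin

text \<open>
  The argument follows Hohenberg and Kohn. Write $W_i = V_0 + V_i$. The energy of a separable potential in
  a symmetric measure depends on the one-particle marginal only, so if the marginals agree, testing the
  variational formula for each potential with the equilibrium measure of the other one gives two
  inequalities whose sum is an equality. Hence $\mu_2$ is an equilibrium measure for both potentials.
  
  It remains to see that two potentials with a common equilibrium measure $\mu$ differ by a constant. Let
  $\psi_1, \psi_2 > 0$ be the ground states, $(L + W_i) \psi_i = \lambda_i \psi_i$. Each of them minimises
  $u \mapsto \int (Lu/u)\,d\mu$, and the vanishing of the first variation has two consequences. First,
  $\mu/\psi_1$ is a left eigenvector of the Schroedinger semigroup, so it has full support by condition
  (B). Second, with $k = \psi_1/\psi_2$, the integral of $L(k^2\psi_2) - 2kL(k\psi_2) + k^2L\psi_2$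
  against $\mu/\psi_1$ is zero. This integrand is bounded below by a positive multiple of the carre du
  champ $\Gamma(k)$ (\<open>carre_du_champ_bounds\<close>). Hence $\Gamma(k) = 0$, so $k$ is constant by (D),
  and $W_1 - W_2 = \lambda_1 - \lambda_2$
  (\<open>common_equilibrium_imp_potentials_differ_by_const\<close>).
  
  The inequalities above are instances of the upper bound in the Donsker-Varadhan formula, which follows from
  the existence of a ground state whose eigenvalue is the principal eigenvalue. To find it, the Schroedinger semigroup is constructed as a
  bounded perturbation (\<open>schrodinger_exists\<close>); it is comparable with the Markov semigroup on nonnegative
  functions (\<open>comparison\<close>), so condition (A) becomes a Harnack inequality for it. The Harnack inequality makes
  the power iteration contract (\<open>harnack_eigenfunction\<close>), and smoothness puts the limit into the core, where
  $L$, products and quotients are available (\<open>ground_state\<close>).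
\<close>

section \<open>Continuous functions on a compact space\<close>

instance bcontfun :: (metric_space, banach) banach ..

text \<open>
  Generators are defined by difference quotients, so the calculus of orbits is done with quotients, and
  this form of the derivative gives access to the chain rule and the mean value theorem.
\<close>

lemma has_vector_derivative_iff_slope:
  fixes f :: "real \<Rightarrow> 'b::real_normed_vector"
  shows "(f has_vector_derivative D) (at x within S) \<longleftrightarrow>
    ((\<lambda>y. (1 / (y - x)) *\<^sub>R (f y - f x)) \<longlongrightarrow> D) (at x within S)"
proof -
  have *: "norm (f y - f x - (y - x) *\<^sub>R D) / norm (y - x) = norm ((1 / (y - x)) *\<^sub>R (f y - f x) - D)"
    if "y \<noteq> x" for y
  proof -
    have "(1 / (y - x)) *\<^sub>R (f y - f x) - D = (1 / (y - x)) *\<^sub>R (f y - f x - (y - x) *\<^sub>R D)"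
      using that by (simp add: scaleR_diff_right)
    then show ?thesis by (simp add: divide_inverse)
  qed
  have "(f has_vector_derivative D) (at x within S) \<longleftrightarrow>
      ((\<lambda>y. norm (f y - f x - (y - x) *\<^sub>R D) / norm (y - x)) \<longlongrightarrow> 0) (at x within S)"
    by (simp add: has_vector_derivative_def has_derivative_iff_norm bounded_linear_scaleR_left)
  also have "\<dots> \<longleftrightarrow> ((\<lambda>y. norm ((1 / (y - x)) *\<^sub>R (f y - f x) - D)) \<longlongrightarrow> 0) (at x within S)"
    by (intro filterlim_cong refl) (auto simp: eventually_at_filter * simp del: real_norm_def)
  also have "\<dots> \<longleftrightarrow> ((\<lambda>y. (1 / (y - x)) *\<^sub>R (f y - f x)) \<longlongrightarrow> D) (at x within S)"
    by (simp add: tendsto_norm_zero_iff LIM_zero_iff)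
  finally show ?thesis .
qed

lemma bounded_linear_eval: "bounded_linear (\<lambda>f :: 'y::topological_space \<Rightarrow>\<^sub>C real. f y)"
  by (rule bounded_linear_intro[where K = 1]) (use norm_bounded in \<open>auto simp flip: real_norm_def\<close>)

lemma tendsto_eval:
  "(f \<longlongrightarrow> l) F \<Longrightarrow> ((\<lambda>x. apply_bcontfun (f x) y) \<longlongrightarrow> apply_bcontfun l y) F" for l :: "'y::topological_space \<Rightarrow>\<^sub>C real"
  by (rule bounded_linear.tendsto[OF bounded_linear_eval])

lemma abs_le_norm: "\<bar>apply_bcontfun f y\<bar> \<le> norm f" for f :: "'y::topological_space \<Rightarrow>\<^sub>C real"
  using norm_bounded[of f y] by simp

lemma norm_leI: "(\<And>y. \<bar>apply_bcontfun f y\<bar> \<le> b) \<Longrightarrow> norm f \<le> b" for f :: "'y::topological_space \<Rightarrow>\<^sub>C real"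
  by (rule norm_bound) simp

context
  assumes K: "compact (UNIV :: 'y::metric_space set)"
begin

lemma abs_C_apply: "abs_C f y = \<bar>f y\<bar>" for f :: "'y \<Rightarrow>\<^sub>C real"
  unfolding abs_C_def by (subst apply_Bcontfun_compact[OF K]) (auto intro!: continuous_intros)

lemma mult_C_apply: "mult_C f g y = f y * g y" for f :: "'y \<Rightarrow>\<^sub>C real"
  unfolding mult_C_def by (subst apply_Bcontfun_compact[OF K]) (auto intro!: continuous_intros)

lemma div_C_apply: "(\<And>y. apply_bcontfun g y \<noteq> 0) \<Longrightarrow> div_C f g y = f y / g y" for f :: "'y \<Rightarrow>\<^sub>C real"
  unfolding div_C_def by (subst apply_Bcontfun_compact[OF K]) (auto intro!: continuous_intros)

lemma attains_min: "\<exists>x. \<forall>y. apply_bcontfun f x \<le> f y" for f :: "'y \<Rightarrow>\<^sub>C real"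
  using continuous_attains_inf[OF K, of "apply_bcontfun f"] by auto

lemma positive_bounded_below:
  fixes f :: "'y \<Rightarrow>\<^sub>C real"
  assumes "\<And>y. 0 < f y" obtains m where "0 < m" "\<And>y. m \<le> f y"
  using attains_min[of f] assms by blast

lemma bounded_linear_mult_C: "bounded_linear (mult_C (f :: 'y \<Rightarrow>\<^sub>C real))"
proof (rule bounded_linear_intro)
  show "mult_C f (g + h) = mult_C f g + mult_C f h" for g h
    by (rule bcontfun_eqI) (simp add: mult_C_apply algebra_simps)
  show "mult_C f (r *\<^sub>R g) = r *\<^sub>R mult_C f g" for r g
    by (rule bcontfun_eqI) (simp add: mult_C_apply algebra_simps)
  show "norm (mult_C f g) \<le> norm g * norm f" for g
    by (rule norm_leI) (auto simp: mult_C_apply abs_mult mult.commute intro!: mult_mono abs_le_norm)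
qed

end

section \<open>Positive semigroups\<close>

lemma gen_domI:
  fixes Q :: "'y::metric_space family"
  assumes "((\<lambda>t. (1 / t) *\<^sub>R (Q t f - f)) \<longlongrightarrow> g) (at_right 0)"
  shows "f \<in> gen_dom Q" "gen Q f = g"
  using assms unfolding gen_dom_def gen_def by (auto intro!: tendsto_Lim)

lemma gen_tendsto:
  fixes Q :: "'y::metric_space family"
  shows "f \<in> gen_dom Q \<Longrightarrow> ((\<lambda>t. (1 / t) *\<^sub>R (Q t f - f)) \<longlongrightarrow> gen Q f) (at_right 0)"
  using gen_domI unfolding gen_dom_def by blast

lemma gen_linear:
  fixes Q :: "'y::metric_space family"
  assumes "f \<in> gen_dom Q" "g \<in> gen_dom Q"
  shows "a *\<^sub>R f + b *\<^sub>R g \<in> gen_dom Q" "gen Q (a *\<^sub>R f + b *\<^sub>R g) = a *\<^sub>R gen Q f + b *\<^sub>R gen Q g"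
proof -
  have "((\<lambda>t. a *\<^sub>R ((1 / t) *\<^sub>R (Q t f - f)) + b *\<^sub>R ((1 / t) *\<^sub>R (Q t g - g))) \<longlongrightarrow> a *\<^sub>R gen Q f + b *\<^sub>R gen Q g) (at_right 0)"
    by (intro tendsto_intros gen_tendsto assms)
  also have "(\<lambda>t. a *\<^sub>R ((1 / t) *\<^sub>R (Q t f - f)) + b *\<^sub>R ((1 / t) *\<^sub>R (Q t g - g))) =
      (\<lambda>t. (1 / t) *\<^sub>R (Q t (a *\<^sub>R f + b *\<^sub>R g) - (a *\<^sub>R f + b *\<^sub>R g)))"
    by (simp add: blinfun.diff_right blinfun.add_right blinfun.scaleR_right blinfun.minus_right algebra_simps)
  finally show "a *\<^sub>R f + b *\<^sub>R g \<in> gen_dom Q" "gen Q (a *\<^sub>R f + b *\<^sub>R g) = a *\<^sub>R gen Q f + b *\<^sub>R gen Q g"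
    by (rule gen_domI)+
qed

locale positive_semigroup =
  fixes Q :: "'y::metric_space family"
  assumes compact_space: "compact (UNIV :: 'y set)"
    and strongly_continuous: "strongly_continuous_semigroup Q"
    and positive: "positive_family Q"
begin

lemma at_zero [simp]: "Q 0 = id_blinfun"
  using strongly_continuous by (simp add: strongly_continuous_semigroup_def)

lemma semigroup: "0 \<le> s \<Longrightarrow> 0 \<le> t \<Longrightarrow> Q (s + t) f = Q s (Q t f)"
  using strongly_continuous by (simp add: strongly_continuous_semigroup_def)

lemma commute: "0 \<le> s \<Longrightarrow> 0 \<le> t \<Longrightarrow> Q s (Q t f) = Q t (Q s f)"
  by (metis semigroup add.commute)

lemma tendsto_at_zero: "((\<lambda>t. Q t f) \<longlongrightarrow> f) (at_right 0)"
  using strongly_continuous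
  by (auto simp: strongly_continuous_semigroup_def tendsto_norm_zero_iff LIM_zero_iff)

lemma mono:
  assumes "0 \<le> t" "\<And>y. apply_bcontfun f y \<le> apply_bcontfun g y" shows "Q t f x \<le> Q t g x"
  using positive[unfolded positive_family_def, rule_format, of t "g - f" x] assms
  by (simp add: blinfun.diff_right blinfun.add_right blinfun.scaleR_right blinfun.minus_right)

lemma nonneg: "0 \<le> t \<Longrightarrow> (\<And>y. 0 \<le> apply_bcontfun f y) \<Longrightarrow> 0 \<le> Q t f x"
  using positive by (auto simp: positive_family_def)

text \<open>
  From \<open>-\<parallel>f\<parallel> \<le> f \<le> \<parallel>f\<parallel>\<close> and positivity. This is why positivity replaces the uniform boundedness
  principle below: convergence of the single orbit of \<open>1\<close> bounds all operators near time zero.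
\<close>

lemma norm_le_norm_one:
  assumes "0 \<le> t" shows "norm (Q t) \<le> norm (Q t (const_bcontfun 1))"
proof (rule norm_blinfun_bound)
  fix f
  show "norm (Q t f) \<le> norm (Q t (const_bcontfun 1)) * norm f"
  proof (rule norm_leI)
    fix y
    have "Q t f y \<le> Q t (norm f *\<^sub>R const_bcontfun 1) y" "Q t (- norm f *\<^sub>R const_bcontfun 1) y \<le> Q t f y"
      using abs_le_norm[of f] by (auto intro!: mono assms simp: abs_le_iff minus_le_iff)
    then have "\<bar>Q t f y\<bar> \<le> norm f * Q t (const_bcontfun 1) y"
      by (auto simp: blinfun.diff_right blinfun.add_right blinfun.scaleR_right blinfun.minus_right)
    also have "\<dots> \<le> norm f * norm (Q t (const_bcontfun 1))"
      using abs_le_norm[of "Q t (const_bcontfun 1)" y] by (intro mult_left_mono) auto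
    finally show "\<bar>Q t f y\<bar> \<le> norm (Q t (const_bcontfun 1)) * norm f" by (simp add: mult.commute)
  qed
qed simp

text \<open>
  Near time zero \<open>\<parallel>Q t\<parallel> \<le> \<parallel>Q t 1\<parallel> \<le> 2\<close>, and longer times are finite compositions of short ones.
\<close>

lemma locally_bounded:
  obtains M where "0 < M" "\<And>t. 0 \<le> t \<Longrightarrow> t \<le> T \<Longrightarrow> norm (Q t) \<le> M"
proof -
  let ?one = "const_bcontfun 1 :: 'y \<Rightarrow>\<^sub>C real"
  have "eventually (\<lambda>t. dist (Q t ?one) ?one < 1) (at_right 0)"
    by (rule tendstoD[OF tendsto_at_zero]) simp
  then obtain \<delta> where \<delta>: "0 < \<delta>" "\<And>t. 0 < t \<Longrightarrow> t < \<delta> \<Longrightarrow> dist (Q t ?one) ?one < 1"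
    by (auto simp: eventually_at_right_field)
  have one: "norm ?one \<le> 1" by (rule norm_leI) simp
  have small: "norm (Q t) \<le> 2" if "0 \<le> t" "t < \<delta>" for t
  proof -
    have "norm (Q t ?one) \<le> norm ?one + dist (Q t ?one) ?one"
      by (simp add: dist_norm) (metis norm_triangle_sub)
    moreover have "dist (Q t ?one) ?one < 1" using \<delta> that by (cases "t = 0") auto
    ultimately show ?thesis using norm_le_norm_one[OF that(1)] one by linarith
  qed
  have iter: "norm (Q (real n * t)) \<le> 2 ^ n" if "0 \<le> t" "t < \<delta>" for t n
  proof (induction n)
    case 0 show ?case by (auto intro: norm_blinfun_id_le)
  next
    case (Suc n)
    have "Q (real (Suc n) * t) = Q t o\<^sub>L Q (real n * t)"
      using that semigroup[of t "real n * t"] by (intro blinfun_eqI) (simp add: algebra_simps)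
    then have "norm (Q (real (Suc n) * t)) \<le> norm (Q t) * norm (Q (real n * t))"
      by (simp add: norm_blinfun_compose)
    also have "\<dots> \<le> 2 * 2 ^ n" by (intro mult_mono Suc small that) auto
    finally show ?case by simp
  qed
  obtain n :: nat where n: "T / \<delta> < real n" "0 < n"
    using reals_Archimedean2[of "max 0 (T / \<delta>)"] by auto
  show ?thesis
  proof (rule that[of "2 ^ n"])
    fix t assume t: "0 \<le> t" "t \<le> T"
    have "t / real n < \<delta>" using n t \<delta>(1) by (simp add: field_simps)
    from iter[OF _ this, of n] show "norm (Q t) \<le> 2 ^ n" using t n by simp
  qed simp
qed

lemma norm_diff_le:
  assumes "0 \<le> s" "0 \<le> t"
  shows "norm (Q s f - Q t f) \<le> norm (Q (min s t)) * norm (Q \<bar>s - t\<bar> f - f)"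
proof -
  have *: "norm (Q s f - Q t f) \<le> norm (Q t) * norm (Q (s - t) f - f)" if "0 \<le> t" "t \<le> s" for s t
    using semigroup[of t "s - t" f] that norm_blinfun[of "Q t" "Q (s - t) f - f"]
    by (simp add: blinfun.diff_right blinfun.add_right blinfun.scaleR_right blinfun.minus_right)
  show ?thesis
    using *[of t s] *[of s t] assms by (cases "t \<le> s") (auto simp: norm_minus_commute min_def)
qed

text \<open>
  Two-sided continuity comes from strong continuity at \<open>0\<close> alone, because
  \<open>Q s f - Q t f\<close> is, up to sign, \<open>Q (min s t)\<close> applied to \<open>Q \<bar>s - t\<bar> f - f\<close>. Letting the argument vary
  with the time is what the product rule for \<open>P (t - s) (Q s f)\<close> needs later.
\<close>

lemma tendsto_joint:
  assumes "(\<tau> \<longlongrightarrow> t) F" "(g \<longlongrightarrow> f) F" "eventually (\<lambda>x. 0 \<le> \<tau> x) F" "0 \<le> t"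
  shows "((\<lambda>x. Q (\<tau> x) (g x)) \<longlongrightarrow> Q t f) F"
proof -
  obtain M where M: "0 < M" "\<And>s. 0 \<le> s \<Longrightarrow> s \<le> t + 1 \<Longrightarrow> norm (Q s) \<le> M"
    using locally_bounded by blast
  have "((\<lambda>d. Q \<bar>d\<bar> f) \<longlongrightarrow> Q \<bar>0\<bar> f) (at 0)"
  proof -
    have "((\<lambda>d. Q \<bar>d\<bar> f) \<longlongrightarrow> f) (at_right 0)"
      by (rule tendsto_cong[THEN iffD1, OF _ tendsto_at_zero]) (auto simp: eventually_at_filter)
    moreover have "((\<lambda>d. Q \<bar>d\<bar> f) \<longlongrightarrow> f) (at_left 0)"
      using calculation by (subst at_left_minus) (simp add: filterlim_filtermap)
    ultimately show ?thesis by (simp add: filterlim_at_split)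
  qed
  then have "isCont (\<lambda>d. Q \<bar>d\<bar> f) 0" by (simp add: isCont_def)
  then have "((\<lambda>x. Q \<bar>\<tau> x - t\<bar> f) \<longlongrightarrow> Q \<bar>0\<bar> f) F"
    by (rule isCont_tendsto_compose) (use assms(1) in \<open>simp add: LIM_zero_iff\<close>)
  then have lim: "((\<lambda>x. M * norm (g x - f) + M * norm (Q \<bar>\<tau> x - t\<bar> f - f)) \<longlongrightarrow> M * 0 + M * 0) F"
    using assms(2) by (intro tendsto_intros) (auto simp: tendsto_norm_zero_iff LIM_zero_iff)
  have "eventually (\<lambda>x. \<tau> x < t + 1) F"
    by (rule order_tendstoD[OF assms(1)]) simp
  with assms(3) have "eventually (\<lambda>x. norm (Q (\<tau> x) (g x) - Q t f) \<le>
      M * norm (g x - f) + M * norm (Q \<bar>\<tau> x - t\<bar> f - f)) F"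
  proof eventually_elim
    case (elim x)
    have "Q (\<tau> x) (g x) - Q t f = Q (\<tau> x) (g x - f) + (Q (\<tau> x) f - Q t f)"
      by (simp add: blinfun.diff_right)
    then have "norm (Q (\<tau> x) (g x) - Q t f) \<le> norm (Q (\<tau> x) (g x - f)) + norm (Q (\<tau> x) f - Q t f)"
      by (simp only: norm_triangle_ineq)
    also have "norm (Q (\<tau> x) (g x - f)) \<le> M * norm (g x - f)"
      using M(2)[of "\<tau> x"] elim
      by (intro order_trans[OF norm_blinfun] mult_right_mono) auto
    also have "norm (Q (\<tau> x) f - Q t f) \<le> M * norm (Q \<bar>\<tau> x - t\<bar> f - f)"
      using M(2)[of "min (\<tau> x) t"] elim assms(4)
      by (intro order_trans[OF norm_diff_le] mult_right_mono) auto
    finally show ?case by simp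
  qed
  from Lim_null_comparison[OF this] lim show ?thesis by (simp add: LIM_zero_iff)
qed

lemma continuous_on_joint:
  assumes "continuous_on A \<tau>" "continuous_on A g" "\<And>x. x \<in> A \<Longrightarrow> 0 \<le> \<tau> x"
  shows "continuous_on A (\<lambda>x. Q (\<tau> x) (g x))"
  using assms unfolding continuous_on_def
  by (auto intro!: tendsto_joint simp: eventually_at_filter)

lemma gen_dom_invariant:
  assumes "f \<in> gen_dom Q" "0 \<le> t"
  shows "Q t f \<in> gen_dom Q" "gen Q (Q t f) = Q t (gen Q f)"
proof -
  have "((\<lambda>s. Q t ((1 / s) *\<^sub>R (Q s f - f))) \<longlongrightarrow> Q t (gen Q f)) (at_right 0)"
    by (intro tendsto_intros gen_tendsto assms)
  then have "((\<lambda>s. (1 / s) *\<^sub>R (Q s (Q t f) - Q t f)) \<longlongrightarrow> Q t (gen Q f)) (at_right 0)"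
    by (rule tendsto_cong[THEN iffD1, rotated])
      (auto simp: eventually_at_filter blinfun.diff_right blinfun.add_right blinfun.scaleR_right blinfun.minus_right commute assms)
  then show "Q t f \<in> gen_dom Q" "gen Q (Q t f) = Q t (gen Q f)" by (rule gen_domI)+
qed

text \<open>
  The generator controls only the right derivative at \<open>0\<close>. Pulling \<open>Q (min s t)\<close> out of the difference
  quotient reduces both one-sided derivatives at \<open>t\<close> to it.
\<close>

lemma has_vector_derivative_orbit:
  assumes "f \<in> gen_dom Q" "0 \<le> t"
  shows "((\<lambda>t. Q t f) has_vector_derivative Q t (gen Q f)) (at t within {0..})"
  unfolding has_vector_derivative_iff_slope
proof -
  have "filterlim (\<lambda>s. \<bar>s - t\<bar>) (at_right 0) (at t within {0..})"
    unfolding filterlim_at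
    by (auto simp: eventually_at_filter intro!: tendsto_eq_intros)
  with gen_tendsto[OF assms(1)]
  have "((\<lambda>s. (1 / \<bar>s - t\<bar>) *\<^sub>R (Q \<bar>s - t\<bar> f - f)) \<longlongrightarrow> gen Q f) (at t within {0..})"
    by (rule filterlim_compose)
  moreover have "((\<lambda>s. min s t) \<longlongrightarrow> t) (at t within {0..})"
    by (auto intro!: tendsto_eq_intros)
  ultimately have "((\<lambda>s. Q (min s t) ((1 / \<bar>s - t\<bar>) *\<^sub>R (Q \<bar>s - t\<bar> f - f))) \<longlongrightarrow> Q t (gen Q f)) (at t within {0..})"
    using assms(2) by (intro tendsto_joint) (auto simp: eventually_at_filter)
  then show "((\<lambda>s. (1 / (s - t)) *\<^sub>R (Q s f - Q t f)) \<longlongrightarrow> Q t (gen Q f)) (at t within {0..})"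
  proof (rule tendsto_cong[THEN iffD1, rotated], unfold eventually_at_filter, intro eventuallyI impI)
    fix s assume "s \<noteq> t" "s \<in> {0..}"
    moreover have "Q s f = Q t (Q (s - t) f)" if "t \<le> s" using semigroup[of t "s - t" f] that assms by simp
    moreover have "Q t f = Q s (Q (t - s) f)" if "s \<le> t" "0 \<le> s" using semigroup[of s "t - s" f] that by simp
    moreover have "(1 / (t - s)) *\<^sub>R (a - b) = (1 / (s - t)) *\<^sub>R (b - a)" for a b :: "'y \<Rightarrow>\<^sub>C real"
    proof -
      have "1 / (t - s) = - (1 / (s - t))" by (simp add: minus_divide_right)
      then show ?thesis by (simp only:) (simp add: scaleR_diff_right)
    qed
    ultimately show "Q (min s t) ((1 / \<bar>s - t\<bar>) *\<^sub>R (Q \<bar>s - t\<bar> f - f)) = (1 / (s - t)) *\<^sub>R (Q s f - Q t f)"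
      by (cases "s < t") (auto simp: blinfun.diff_right blinfun.add_right blinfun.scaleR_right blinfun.minus_right min_def)
  qed
qed

end

text \<open>
  A functional that turns the generator into multiplication by \<open>l\<close> along the orbit turns the semigroup
  into \<open>exp (l t)\<close>. Point evaluations at an eigenfunction and the measure \<open>\<mu> / \<psi>\<close> of an equilibrium measure
  are the two applications.
\<close>

lemma (in positive_semigroup) exponential_orbit:
  fixes \<nu> :: "('y \<Rightarrow>\<^sub>C real) \<Rightarrow> real"
  assumes \<nu>: "bounded_linear \<nu>" and f: "f \<in> gen_dom Q" and "0 \<le> t"
    and eq: "\<And>s. 0 \<le> s \<Longrightarrow> \<nu> (Q s (gen Q f)) = l * \<nu> (Q s f)"
  shows "\<nu> (Q t f) = exp (l * t) * \<nu> f"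
proof -
  let ?\<phi> = "\<lambda>s. exp (- l * s) * \<nu> (Q s f)"
  have d: "(?\<phi> has_real_derivative 0) (at s within {0..})" if "0 \<le> s" for s
  proof -
    have "((\<lambda>s. \<nu> (Q s f)) has_real_derivative l * \<nu> (Q s f)) (at s within {0..})"
      using bounded_linear.has_vector_derivative[OF \<nu> has_vector_derivative_orbit[OF f that]]
      by (simp add: has_real_derivative_iff_has_vector_derivative eq[OF that])
    note this[derivative_intros]
    show ?thesis by (auto intro!: derivative_eq_intros)
  qed
  have "\<exists>c. \<forall>s\<in>{0..}. ?\<phi> s = c"
    by (rule has_field_derivative_zero_constant) (use d in auto)
  then obtain c where c: "\<And>s. 0 \<le> s \<Longrightarrow> ?\<phi> s = c" by auto
  have "?\<phi> t = ?\<phi> 0" by (simp only: c[OF assms(3)] c[OF order_refl])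
  then show ?thesis by (simp add: exp_minus field_simps)
qed

section \<open>Bounded perturbations of the generator\<close>

text \<open>
  The semigroup generated by \<open>L + B\<close> is built from Duhamel's equation
  \<open>u(t) = S(t) f + \<integral>\<^sub>0\<^sup>t S(t - s) B u(s) ds\<close>. The decay rate \<open>\<beta>\<close> of \<open>S\<close> is assumed to be at least twice the
  norm of \<open>B\<close>, so that the right-hand side is a contraction on bounded continuous functions of
  \<open>t \<in> [0, \<infinity>)\<close> and the solution is global at once. Multiplying a given semigroup by an
  exponential achieves any decay rate. Positivity of \<open>B\<close> makes the solution positive.
\<close>

locale perturbed_semigroup = positive_semigroup S for S :: "'y::metric_space family" +
  fixes B :: "('y \<Rightarrow>\<^sub>C real) \<Rightarrow>\<^sub>L ('y \<Rightarrow>\<^sub>C real)" and \<beta> :: real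
  assumes \<beta>_pos: "0 < \<beta>"
    and decay: "\<And>t. 0 \<le> t \<Longrightarrow> norm (S t) \<le> exp (- \<beta> * t)"
    and B_small: "norm B \<le> \<beta> / 2"
    and B_pos: "\<And>f y. (\<And>z. 0 \<le> apply_bcontfun f z) \<Longrightarrow> 0 \<le> B f y"
begin

lemma contraction: "0 \<le> t \<Longrightarrow> norm (S t f) \<le> norm f"
proof -
  assume "0 \<le> t"
  then have "norm (S t) \<le> 1" using decay[of t] \<beta>_pos by (smt (verit) exp_le_one_iff mult_nonneg_nonneg mult_minus_left)
  then show ?thesis using norm_blinfun[of "S t" f] mult_right_mono[of "norm (S t)" 1 "norm f"] by simp
qed

definition conv :: "(real \<Rightarrow> ('y \<Rightarrow>\<^sub>C real)) \<Rightarrow> real \<Rightarrow> ('y \<Rightarrow>\<^sub>C real)" where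
  "conv g t = integral {0..t} (\<lambda>s. S (t - s) (g s))"

lemma conv_integrand_continuous:
  "continuous_on {0..} g \<Longrightarrow> continuous_on {0..t} (\<lambda>s. S (t - s) (g s))"
  by (intro continuous_on_joint) (auto intro!: continuous_intros elim: continuous_on_subset)

lemma conv_integrable:
  "continuous_on {0..} g \<Longrightarrow> (\<lambda>s. S (t - s) (g s)) integrable_on {0..t}"
  by (intro integrable_continuous_real conv_integrand_continuous)

text \<open>
  The kernel is bounded by \<open>exp (- \<beta> (t - s))\<close>, whose integral over \<open>s\<close> is at most \<open>1 / \<beta>\<close>.
\<close>

lemma norm_conv_le:
  assumes "continuous_on {0..} g" "\<And>s. 0 \<le> s \<Longrightarrow> norm (g s) \<le> b" "0 \<le> t"
  shows "norm (conv g t) \<le> b / \<beta>"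
proof -
  have b: "0 \<le> b" using assms(2)[of 0] norm_ge_zero[of "g 0"] by linarith
  have int: "((\<lambda>s. exp (- \<beta> * (t - s)) * b) has_integral
      (exp (- \<beta> * (t - t)) * b / \<beta> - exp (- \<beta> * (t - 0)) * b / \<beta>)) {0..t}"
    using assms(3) \<beta>_pos
    by (intro fundamental_theorem_of_calculus)
      (auto intro!: derivative_eq_intros simp: has_real_derivative_iff_has_vector_derivative[symmetric])
  have "norm (conv g t) \<le> integral {0..t} (\<lambda>s. exp (- \<beta> * (t - s)) * b)"
    unfolding conv_def
  proof (rule Henstock_Kurzweil_Integration.integral_norm_bound_integral)
    show "(\<lambda>s. exp (- \<beta> * (t - s)) * b) integrable_on {0..t}" using int by blast
    fix s assume "s \<in> {0..t}"
    then show "norm (S (t - s) (g s)) \<le> exp (- \<beta> * (t - s)) * b"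
      by (intro order_trans[OF norm_blinfun] mult_mono decay assms) auto
  qed (rule conv_integrable[OF assms(1)])
  also have "\<dots> = exp (- \<beta> * (t - t)) * b / \<beta> - exp (- \<beta> * (t - 0)) * b / \<beta>"
    using int by (rule integral_unique)
  also have "\<dots> \<le> b / \<beta>" using b \<beta>_pos by (simp add: field_simps)
  finally show ?thesis .
qed

lemma continuous_on_conv:
  assumes g: "continuous_on {0..} g"
  shows "continuous_on {0..} (conv g)"
proof -
  have *: "continuous_on {0..R} (conv g)" for R
  proof -
    have int: "g integrable_on {0..R}"
      by (intro integrable_continuous_real) (rule continuous_on_subset[OF g], simp)
    \<comment> \<open>The truncated kernel is the identity for \<open>s \<ge> t\<close>, which moves the variable end point of the integral into the continuous integral of \<open>g\<close> over \<open>[t, R]\<close>.\<close>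
    let ?F = "\<lambda>t s. S (max 0 (t - s)) (g s)"
    have contF: "continuous_on {0..R} (?F t)" for t
      by (intro continuous_on_joint) (auto intro!: continuous_intros continuous_on_subset[OF g])
    have "continuous_on ({0..R} \<times> cbox 0 R) (\<lambda>(t, s). ?F t s)"
      unfolding split_beta
      by (intro continuous_on_joint continuous_on_compose2[OF g]) (auto intro!: continuous_intros)
    then have "continuous_on {0..R} (\<lambda>t. integral (cbox 0 R) (?F t))"
      by (rule integral_continuous_on_param)
    then have "continuous_on {0..R} (\<lambda>t. integral {0..R} (?F t) - integral {t..R} g)"
      by (intro continuous_intros indefinite_integral_continuous_1' int) simp
    then show ?thesis
    proof (rule continuous_on_cong[THEN iffD1, rotated 2])
      fix t assume t: "t \<in> {0..R}"
      have "integral {0..R} (?F t) = integral {0..t} (?F t) + integral {t..R} (?F t)"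
        using t by (intro Henstock_Kurzweil_Integration.integral_combine[symmetric] integrable_continuous_real contF) auto
      also have "integral {0..t} (?F t) = conv g t"
        unfolding conv_def by (intro integral_cong) simp
      also have "integral {t..R} (?F t) = integral {t..R} g"
        by (intro integral_cong) simp
      finally show "integral {0..R} (?F t) - integral {t..R} g = conv g t" by simp
    qed simp
  qed
  show ?thesis
    unfolding continuous_on_eq_continuous_within
  proof
    fix t :: real assume t: "t \<in> {0..}"
    then have "continuous (at t within {0..t+1}) (conv g)"
      using *[of "t + 1"] by (auto simp: continuous_on_eq_continuous_within)
    also have "at t within {0..t+1} = at t within {0..}"
      by (rule at_within_nhd[of _ "{..<t + 1}"]) auto
    finally show "continuous (at t within {0..}) (conv g)" .
  qed
qed

lemma conv_add:
  assumes "continuous_on {0..} g" "continuous_on {0..} h"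
  shows "conv (\<lambda>s. g s + h s) t = conv g t + conv h t"
  unfolding conv_def blinfun.add_right
  using conv_integrable[OF assms(1)] conv_integrable[OF assms(2)] by (rule Henstock_Kurzweil_Integration.integral_add)

lemma conv_scaleR: "conv (\<lambda>s. r *\<^sub>R g s) t = r *\<^sub>R conv g t"
  unfolding conv_def blinfun.scaleR_right by (rule integral_cmul)

lemma conv_nonneg:
  assumes "continuous_on {0..} g" "\<And>s z. 0 \<le> s \<Longrightarrow> 0 \<le> apply_bcontfun (g s) z"
  shows "0 \<le> conv g t y"
proof -
  have "conv g t y = integral {0..t} ((\<lambda>f. apply_bcontfun f y) \<circ> (\<lambda>s. S (t - s) (g s)))"
    unfolding conv_def
    by (rule integral_linear[OF conv_integrable[OF assms(1)] bounded_linear_eval, symmetric])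
  also have "\<dots> \<ge> 0"
    by (intro Henstock_Kurzweil_Integration.integral_nonneg integrable_linear[OF conv_integrable[OF assms(1)] bounded_linear_eval])
      (auto intro!: nonneg assms(2))
  finally show ?thesis .
qed

lemma conv_shift:
  assumes g: "continuous_on {0..} g" and "0 \<le> r" "0 \<le> t"
  shows "conv g (t + r) = S t (conv g r) + conv (\<lambda>s. g (s + r)) t"
proof -
  have "conv g (t + r) = integral {0..r} (\<lambda>s. S (t + r - s) (g s)) + integral {r..t + r} (\<lambda>s. S (t + r - s) (g s))"
    unfolding conv_def using assms
    by (intro Henstock_Kurzweil_Integration.integral_combine[symmetric] conv_integrable) auto
  also have "integral {0..r} (\<lambda>s. S (t + r - s) (g s)) = integral {0..r} (S t \<circ> (\<lambda>s. S (r - s) (g s)))"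
    using assms semigroup[of t "r - _"] by (intro integral_cong) (auto simp: algebra_simps)
  also have "\<dots> = S t (conv g r)"
    unfolding conv_def by (rule integral_linear[OF conv_integrable[OF g]]) (rule blinfun.bounded_linear_right)
  also have "integral {r..t + r} (\<lambda>s. S (t + r - s) (g s)) = integral {r - r..t + r - r} (\<lambda>s. S (t + r - (s + r)) (g (s + r)))"
    by (rule integral_shift_real_ivl[symmetric])
  also have "\<dots> = conv (\<lambda>s. g (s + r)) t"
    by (simp add: conv_def)
  finally show ?thesis .
qed

text \<open>
  The Duhamel term is \<open>t g(0)\<close> to first order; this identifies the generator of the perturbed semigroup.
\<close>

lemma conv_derivative_at_0:
  assumes g: "continuous_on {0..} g"
  shows "((\<lambda>t. (1 / t) *\<^sub>R conv g t) \<longlongrightarrow> g 0) (at_right 0)"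
proof (rule tendstoI)
  fix e :: real assume e: "0 < e"
  have "(g \<longlongrightarrow> g 0) (at_right 0)"
    using g by (auto simp: continuous_on_def intro: tendsto_within_subset)
  then have "eventually (\<lambda>s. dist (g s) (g 0) < e / 3) (at_right 0)" using e by (intro tendstoD) auto
  moreover have "eventually (\<lambda>s. dist (S s (g 0)) (g 0) < e / 3) (at_right 0)"
    using e by (intro tendstoD tendsto_at_zero) auto
  ultimately have "eventually (\<lambda>s. dist (g s) (g 0) < e / 3 \<and> dist (S s (g 0)) (g 0) < e / 3) (at_right 0)"
    by (rule eventually_conj)
  then obtain \<delta> where \<delta>: "0 < \<delta>"
    "\<And>s. 0 < s \<Longrightarrow> s < \<delta> \<Longrightarrow> dist (g s) (g 0) < e / 3 \<and> dist (S s (g 0)) (g 0) < e / 3"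
    by (auto simp: eventually_at_right_field)
  have \<delta>': "norm (g s - g 0) \<le> e / 3" "norm (S s (g 0) - g 0) \<le> e / 3" if "0 \<le> s" "s < \<delta>" for s
    using \<delta>(2)[of s] that e by (cases "s = 0"; simp add: dist_norm)+
  have "dist ((1 / t) *\<^sub>R conv g t) (g 0) < e" if t: "0 < t" "t < \<delta>" for t
  proof -
    have "conv g t - t *\<^sub>R g 0 = integral {0..t} (\<lambda>s. S (t - s) (g s)) - integral {0..t} (\<lambda>s. g 0)"
      using t by (simp add: conv_def)
    also have "\<dots> = integral {0..t} (\<lambda>s. S (t - s) (g s) - g 0)"
      by (rule Henstock_Kurzweil_Integration.integral_diff[symmetric]) (auto intro: conv_integrable[OF g])
    also have "norm \<dots> \<le> (2 * e / 3) * (t - 0)"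
    proof (rule integral_bound)
      fix s assume s: "s \<in> {0..t}"
      have "S (t - s) (g s) - g 0 = S (t - s) (g s - g 0) + (S (t - s) (g 0) - g 0)"
        by (simp add: blinfun.diff_right)
      then have "norm (S (t - s) (g s) - g 0) \<le> norm (S (t - s) (g s - g 0)) + norm (S (t - s) (g 0) - g 0)"
        by (simp only: norm_triangle_ineq)
      also have "\<dots> \<le> norm (g s - g 0) + norm (S (t - s) (g 0) - g 0)"
        using s by (intro add_mono contraction) auto
      also have "\<dots> \<le> e / 3 + e / 3"
        using s t by (intro add_mono \<delta>') auto
      finally show "norm (S (t - s) (g s) - g 0) \<le> 2 * e / 3" by simp
    qed (use t in \<open>auto intro!: continuous_intros conv_integrand_continuous g\<close>)
    finally have "norm (conv g t - t *\<^sub>R g 0) \<le> (2 * e / 3) * t" by simp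
    moreover have "(1 / t) *\<^sub>R conv g t - g 0 = (1 / t) *\<^sub>R (conv g t - t *\<^sub>R g 0)"
      using t by (simp add: scaleR_diff_right)
    then have "dist ((1 / t) *\<^sub>R conv g t) (g 0) = norm (conv g t - t *\<^sub>R g 0) / t"
      using t by (simp only: dist_norm norm_scaleR) simp
    ultimately have "dist ((1 / t) *\<^sub>R conv g t) (g 0) \<le> 2 * e / 3"
      using t by (simp add: divide_le_eq)
    then show ?thesis using e by simp
  qed
  then show "eventually (\<lambda>t. dist ((1 / t) *\<^sub>R conv g t) (g 0) < e) (at_right 0)"
    using \<delta>(1) by (auto simp: eventually_at_right_field)
qed

text \<open>
  Solutions are elements of a space of bounded continuous functions on the whole line, kept constant for
  negative times, so that Banach's fixed point theorem applies to a complete type.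
\<close>

definition duhamel :: "('y \<Rightarrow>\<^sub>C real) \<Rightarrow> (real \<Rightarrow>\<^sub>C ('y \<Rightarrow>\<^sub>C real)) \<Rightarrow> (real \<Rightarrow>\<^sub>C ('y \<Rightarrow>\<^sub>C real))" where
  "duhamel f w = Bcontfun (\<lambda>t. S (max 0 t) f + conv (\<lambda>s. B (w s)) (max 0 t))"

lemma continuous_on_B: "continuous_on A g \<Longrightarrow> continuous_on A (\<lambda>s. B (g s))"
  by (intro continuous_intros)

lemma norm_conv_B_le:
  fixes w :: "real \<Rightarrow>\<^sub>C ('y \<Rightarrow>\<^sub>C real)"
  assumes "0 \<le> t"
  shows "norm (conv (\<lambda>s. B (w s)) t) \<le> norm w / 2"
proof -
  have "norm (conv (\<lambda>s. B (w s)) t) \<le> (\<beta> / 2 * norm w) / \<beta>"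
    by (intro norm_conv_le continuous_on_B continuous_on_apply_bcontfun assms
        order_trans[OF norm_blinfun] mult_mono B_small norm_bounded) (use \<beta>_pos in auto)
  then show ?thesis using \<beta>_pos by simp
qed

lemma duhamel_apply: "duhamel f w t = S (max 0 t) f + conv (\<lambda>s. B (w s)) (max 0 t)"
proof -
  have "(\<lambda>t. S (max 0 t) f + conv (\<lambda>s. B (w s)) (max 0 t)) \<in> bcontfun"
  proof (rule bcontfun_normI)
    show "continuous_on UNIV (\<lambda>t. S (max 0 t) f + conv (\<lambda>s. B (w s)) (max 0 t))"
      by (intro continuous_on_add continuous_on_joint
          continuous_on_compose2[OF continuous_on_conv[OF continuous_on_B]])
        (auto intro!: continuous_intros)
    show "norm (S (max 0 t) f + conv (\<lambda>s. B (w s)) (max 0 t)) \<le> norm f + norm w / 2" for t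
      by (intro order_trans[OF norm_triangle_ineq] add_mono contraction norm_conv_B_le) auto
  qed
  then show ?thesis by (simp add: duhamel_def Bcontfun_inverse)
qed

lemma duhamel_add: "duhamel (f + g) (v + w) = duhamel f v + duhamel g w"
  by (rule bcontfun_eqI)
    (simp add: duhamel_apply blinfun.add_right conv_add continuous_on_B)

lemma duhamel_scaleR: "duhamel (r *\<^sub>R f) (r *\<^sub>R w) = r *\<^sub>R duhamel f w"
  by (rule bcontfun_eqI)
    (simp add: duhamel_apply blinfun.scaleR_right conv_scaleR algebra_simps)

lemma duhamel_contraction: "dist (duhamel f v) (duhamel f w) \<le> 1 / 2 * dist v w"
proof -
  have "duhamel f v - duhamel f w = duhamel 0 (v - w)"
    using duhamel_add[of 0 f "v - w" w] by simp
  moreover have "norm (duhamel 0 (v - w)) \<le> norm (v - w) / 2"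
    by (rule norm_bound) (use norm_conv_B_le[of "max 0 _" "v - w"] in \<open>simp add: duhamel_apply\<close>)
  ultimately show ?thesis by (simp add: dist_norm)
qed

lemma duhamel_unique: "duhamel f v = v \<Longrightarrow> duhamel f w = w \<Longrightarrow> v = w"
  using duhamel_contraction[of f v w] by (simp add: dist_le_zero_iff)

definition flow :: "('y \<Rightarrow>\<^sub>C real) \<Rightarrow> (real \<Rightarrow>\<^sub>C ('y \<Rightarrow>\<^sub>C real))" where
  "flow f = (THE w. duhamel f w = w)"

lemma duhamel_flow: "duhamel f (flow f) = flow f"
proof -
  have "\<exists>!w. duhamel f w = w"
    by (rule banach_fix_type[of "1/2"]) (auto intro: duhamel_contraction[simplified])
  then show ?thesis unfolding flow_def by (rule theI')
qed

lemma flow_eqI: "duhamel f w = w \<Longrightarrow> flow f = w"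
  using duhamel_unique duhamel_flow by blast

text \<open>
  The nonnegative paths form a closed set invariant under the Duhamel map, so the fixed point lies in it.
\<close>

lemma flow_nonneg:
  assumes "\<And>y. 0 \<le> apply_bcontfun f y"
  shows "0 \<le> flow f t y"
proof -
  define A where "A = PiC UNIV (\<lambda>_::real. \<Inter>y. {h :: 'y \<Rightarrow>\<^sub>C real. 0 \<le> h y})"
  have memA: "w \<in> A \<longleftrightarrow> (\<forall>t y. 0 \<le> w t y)" for w
    unfolding A_def by (auto simp: mem_PiC_iff Pi_iff)
  have "closed A" unfolding A_def
    by (intro closed_PiC closed_INT ballI closed_Collect_le continuous_intros
        linear_continuous_on bounded_linear_eval)
  then have "\<exists>!w\<in>A. duhamel f w = w"
  proof (intro Banach_fix[of A "1/2"] duhamel_contraction)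
    show "duhamel f ` A \<subseteq> A"
      by (auto simp: memA duhamel_apply
          intro!: add_nonneg_nonneg nonneg assms conv_nonneg continuous_on_B B_pos)
    have "0 \<in> A" by (simp add: memA)
    then show "A \<noteq> {}" by auto
  qed (auto simp: complete_eq_closed)
  then show ?thesis using flow_eqI memA by metis
qed

lemma flow_apply: "0 \<le> t \<Longrightarrow> flow f t = S t f + conv (\<lambda>s. B (flow f s)) t"
  using duhamel_apply[of f "flow f" t] by (simp add: duhamel_flow)

definition perturbed :: "'y family" where
  "perturbed t = Blinfun (\<lambda>f. flow f (max 0 t))"

lemma perturbed_apply: assumes "0 \<le> t" shows "perturbed t f = flow f t"
proof -
  have "bounded_linear (\<lambda>f. flow f (max 0 t))"
  proof (rule bounded_linear_intro)
    show "flow (f + g) (max 0 t) = flow f (max 0 t) + flow g (max 0 t)" for f g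
      using flow_eqI[of "f + g" "flow f + flow g"] by (simp add: duhamel_add duhamel_flow)
    show "flow (r *\<^sub>R f) (max 0 t) = r *\<^sub>R flow f (max 0 t)" for r f
      using flow_eqI[of "r *\<^sub>R f" "r *\<^sub>R flow f"] by (simp add: duhamel_scaleR duhamel_flow)
    show "norm (flow f (max 0 t)) \<le> norm f * 2" for f
    proof -
      have "norm (flow f) \<le> norm f + norm (flow f) / 2"
      proof (rule norm_bound)
        fix s
        have "flow f s = S (max 0 s) f + conv (\<lambda>r. B (flow f r)) (max 0 s)"
          using duhamel_apply[of f "flow f" s] by (simp add: duhamel_flow)
        then show "norm (flow f s) \<le> norm f + norm (flow f) / 2"
          by (metis add_mono contraction max.cobounded1 norm_conv_B_le norm_triangle_le)
      qed
      then show ?thesis using norm_bounded[of "flow f" "max 0 t"] by simp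
    qed
  qed
  then show ?thesis using assms by (simp add: perturbed_def bounded_linear_Blinfun_apply)
qed

text \<open>
  Both sides, as functions of \<open>t\<close>, solve the Duhamel equation started at \<open>flow f r\<close>, by splitting
  the integral at \<open>r\<close>; uniqueness gives equality.
\<close>

lemma flow_semigroup:
  assumes "0 \<le> r" "0 \<le> t"
  shows "flow f (t + r) = flow (flow f r) t"
proof -
  define w where "w = Bcontfun (\<lambda>t. flow f (max 0 t + r))"
  have w: "apply_bcontfun w = (\<lambda>t. flow f (max 0 t + r))"
    unfolding w_def
    by (intro Bcontfun_inverse bcontfun_normI[where b = "norm (flow f)"] continuous_on_compose2[OF continuous_on_apply_bcontfun])
      (auto intro!: continuous_intros norm_bounded)
  have "duhamel (flow f r) w = w"
  proof (rule bcontfun_eqI)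
    fix t :: real
    let ?t = "max 0 t" and ?g = "\<lambda>s. B (flow f s)"
    have g: "continuous_on {0..} ?g" by (intro continuous_on_B continuous_on_apply_bcontfun)
    have "conv (\<lambda>s. B (w s)) ?t = conv (\<lambda>s. ?g (s + r)) ?t"
      unfolding conv_def by (intro integral_cong) (simp add: w)
    then have "duhamel (flow f r) w t = S ?t (S r f) + (S ?t (conv ?g r) + conv (\<lambda>s. ?g (s + r)) ?t)"
      using assms by (simp add: duhamel_apply flow_apply[of r] blinfun.add_right)
    also have "\<dots> = S (?t + r) f + conv ?g (?t + r)"
      using assms g by (simp add: conv_shift semigroup)
    also have "\<dots> = w t" using assms by (simp add: w flow_apply[of "?t + r"])
    finally show "duhamel (flow f r) w t = w t" .
  qed
  from flow_eqI[OF this] show ?thesis using assms by (simp add: w)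
qed

lemma flow_0: "flow f 0 = f"
  by (simp add: flow_apply conv_def)

lemma positive_semigroup_perturbed: "positive_semigroup perturbed"
proof
  have "((\<lambda>t. flow f t) \<longlongrightarrow> flow f 0) (at_right 0)" for f
    using continuous_on_apply_bcontfun[of UNIV "flow f"]
    by (auto simp: continuous_on_def intro: tendsto_within_subset)
  then have "((\<lambda>t. perturbed t f) \<longlongrightarrow> f) (at_right 0)" for f
    unfolding flow_0 by (rule tendsto_cong[THEN iffD1, rotated])
      (auto simp: eventually_at_filter perturbed_apply)
  then show "strongly_continuous_semigroup perturbed"
    unfolding strongly_continuous_semigroup_def
    by (auto intro!: blinfun_eqI simp: perturbed_apply flow_0 flow_semigroup[symmetric] add.commute
        tendsto_norm_zero_iff LIM_zero_iff)
  show "positive_family perturbed"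
    by (auto simp: positive_family_def perturbed_apply flow_nonneg)
qed (rule compact_space)

text \<open>
  The difference quotients of the two semigroups differ by the Duhamel term divided by \<open>t\<close>. Hence they
  converge for the same \<open>f\<close>, which gives equality of the domains.
\<close>

lemma perturbed_gen:
  "((\<lambda>t. (1 / t) *\<^sub>R (perturbed t f - f) - (1 / t) *\<^sub>R (S t f - f)) \<longlongrightarrow> B f) (at_right 0)"
proof -
  have "((\<lambda>t. (1 / t) *\<^sub>R conv (\<lambda>s. B (flow f s)) t) \<longlongrightarrow> B (flow f 0)) (at_right 0)"
    by (intro conv_derivative_at_0 continuous_on_B continuous_on_apply_bcontfun)
  then show ?thesis
    unfolding flow_0 by (rule tendsto_cong[THEN iffD1, rotated])
      (auto simp: eventually_at_filter perturbed_apply flow_apply algebra_simps)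
qed

lemma gen_dom_perturbed: "gen_dom perturbed = gen_dom S"
  and gen_perturbed: "f \<in> gen_dom S \<Longrightarrow> gen perturbed f = gen S f + B f"
proof -
  have *: "f \<in> gen_dom perturbed" "gen perturbed f = gen S f + B f" if "f \<in> gen_dom S" for f
    using gen_domI[of perturbed f] tendsto_add[OF gen_tendsto[OF that] perturbed_gen[of f]] by simp_all
  moreover have "f \<in> gen_dom S" if "f \<in> gen_dom perturbed" for f
    using gen_domI(1)[of S f] tendsto_diff[OF gen_tendsto[OF that] perturbed_gen[of f]] by simp
  ultimately show "gen_dom perturbed = gen_dom S" "f \<in> gen_dom S \<Longrightarrow> gen perturbed f = gen S f + B f"
    by blast+
qed

end

text \<open>
  Rescaling in time by an exponential shifts the generator by a constant; it is used to gain decay before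
  the perturbation and to undo the shift afterwards.
\<close>

lemma (in positive_semigroup) exp_scaled:
  fixes a :: real
  defines "R \<equiv> \<lambda>t. exp (a * t) *\<^sub>R Q t"
  shows "positive_semigroup R" "gen_dom R = gen_dom Q" "f \<in> gen_dom Q \<Longrightarrow> gen R f = gen Q f + a *\<^sub>R f"
proof -
  have e: "((\<lambda>t. exp (a * t)) \<longlongrightarrow> 1) (at_right 0)"
    by (auto intro!: tendsto_eq_intros)
  show "positive_semigroup R"
  proof
    have "((\<lambda>t. R t f) \<longlongrightarrow> 1 *\<^sub>R f) (at_right 0)" for f
      unfolding R_def blinfun.scaleR_left by (intro tendsto_intros e tendsto_at_zero)
    then show "strongly_continuous_semigroup R"
      unfolding strongly_continuous_semigroup_def
      by (auto intro!: blinfun_eqI simp: R_def semigroup blinfun.scaleR_left blinfun.scaleR_right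
          exp_add distrib_left tendsto_norm_zero_iff LIM_zero_iff)
    show "positive_family R"
      by (auto simp: positive_family_def R_def blinfun.scaleR_left nonneg)
  qed (rule compact_space)
  have "((\<lambda>t. (exp (a * t) - 1) / t) \<longlongrightarrow> a) (at_right 0)"
  proof -
    have "((\<lambda>t. exp (a * t)) has_real_derivative a) (at 0)"
      by (auto intro!: derivative_eq_intros)
    then have "((\<lambda>t. (exp (a * t) - 1) / t) \<longlongrightarrow> a) (at 0)"
      by (simp add: DERIV_def)
    then show ?thesis by (rule tendsto_within_subset) simp
  qed
  note d = this
  have key: "((\<lambda>t. (1 / t) *\<^sub>R (R t f - f) - (1 / t) *\<^sub>R (Q t f - f)) \<longlongrightarrow> a *\<^sub>R f) (at_right 0)" for f
  proof -
    have "((\<lambda>t. ((exp (a * t) - 1) / t) *\<^sub>R Q t f) \<longlongrightarrow> a *\<^sub>R f) (at_right 0)"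
      by (intro tendsto_intros d tendsto_at_zero)
    then show ?thesis
      by (rule tendsto_cong[THEN iffD1, rotated])
        (auto simp: eventually_at_filter R_def blinfun.scaleR_left algebra_simps diff_divide_distrib)
  qed
  have *: "f \<in> gen_dom R" "gen R f = gen Q f + a *\<^sub>R f" if "f \<in> gen_dom Q" for f
    using gen_domI[of R f] tendsto_add[OF gen_tendsto[OF that] key[of f]] by simp_all
  moreover have "f \<in> gen_dom Q" if "f \<in> gen_dom R" for f
    using gen_domI(1)[of Q f] tendsto_diff[OF gen_tendsto[OF that] key[of f]] by simp
  ultimately show "gen_dom R = gen_dom Q" "f \<in> gen_dom Q \<Longrightarrow> gen R f = gen Q f + a *\<^sub>R f"
    by blast+
qed

locale markov = positive_semigroup P for P :: "'y::metric_space family" +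
  assumes unit: "0 \<le> t \<Longrightarrow> P t (const_bcontfun 1) = const_bcontfun 1"
begin

lemma norm_le_one: "0 \<le> t \<Longrightarrow> norm (P t) \<le> 1"
  using norm_le_norm_one[of t] norm_leI[of "const_bcontfun 1 :: 'y \<Rightarrow>\<^sub>C real" 1] by (simp add: unit)

lemma schrodinger_exists: "\<exists>Q. is_schrodinger P V Q"
proof -
  \<comment> \<open>The potential is shifted by \<open>c\<close> to become nonnegative with norm at most \<open>2 c\<close>, and \<open>\<beta>\<close> is at least twice that.\<close>
  define c where "c = norm V"
  define \<beta> where "\<beta> = 4 * c + 1"
  define U where "U = V + const_bcontfun c"
  define B where "B = Blinfun (mult_C U)"
  define S where "S t = exp (- \<beta> * t) *\<^sub>R P t" for t
  have c: "0 \<le> c" by (simp add: c_def)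
  have U: "0 \<le> U y" "U y \<le> 2 * c" for y
    using abs_le_norm[of V y] by (auto simp: U_def c_def)
  have B: "B f = mult_C U f" for f
    unfolding B_def by (simp add: bounded_linear_Blinfun_apply bounded_linear_mult_C compact_space)
  interpret S: positive_semigroup S unfolding S_def by (rule exp_scaled)
  interpret S: perturbed_semigroup S B \<beta>
  proof
    show "0 < \<beta>" using c by (simp add: \<beta>_def)
    show "norm (S t) \<le> exp (- \<beta> * t)" if "0 \<le> t" for t
      using norm_le_one[OF that] by (simp add: S_def)
    have "norm (B f) \<le> 2 * c * norm f" for f
    proof (rule norm_leI)
      fix y
      show "\<bar>B f y\<bar> \<le> 2 * c * norm f"
        using U[of y] by (auto simp: B mult_C_apply compact_space abs_mult intro!: mult_mono abs_le_norm)
    qed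
    then have "norm B \<le> 2 * c" using c by (intro norm_blinfun_bound) auto
    then show "norm B \<le> \<beta> / 2" by (simp add: \<beta>_def)
    show "0 \<le> B f y" if "\<And>z. 0 \<le> apply_bcontfun f z" for f y
      using U[of y] that[of y] by (simp add: B mult_C_apply compact_space)
  qed
  interpret R: positive_semigroup S.perturbed by (rule S.positive_semigroup_perturbed)
  define Q where "Q t = exp ((\<beta> - c) * t) *\<^sub>R S.perturbed t" for t
  have dom: "gen_dom S = gen_dom P" "f \<in> gen_dom P \<Longrightarrow> gen S f = gen P f + - \<beta> *\<^sub>R f" for f
    unfolding S_def by (rule exp_scaled)+
  have "positive_semigroup Q" "gen_dom Q = gen_dom P"
    "\<And>f. f \<in> gen_dom P \<Longrightarrow> gen Q f = gen S f + B f + (\<beta> - c) *\<^sub>R f"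
    using R.exp_scaled[where a = "\<beta> - c"] S.gen_perturbed S.gen_dom_perturbed dom unfolding Q_def by auto
  moreover have "mult_C U f = mult_C V f + c *\<^sub>R f" for f
    by (rule bcontfun_eqI) (simp add: mult_C_apply compact_space U_def algebra_simps)
  ultimately show ?thesis
    by (intro exI[of _ Q])
      (auto simp: is_schrodinger_def positive_semigroup_def dom B algebra_simps)
qed

lemma is_schrodinger: "is_schrodinger P V (schrodinger P V)"
  unfolding schrodinger_def by (rule someI_ex[of "is_schrodinger P V"]) (rule schrodinger_exists)

end

section \<open>Positive eigenfunctions from a Harnack inequality\<close>

text \<open>
  One step of the normalised power iteration. If \<open>m u \<le> A u \<le> M u\<close>, the Harnack inequality applied to the
  nonnegative functions \<open>A u - m u\<close> and \<open>M u - A u\<close> improves both bounds at the next iterate; the new gap is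
  exactly \<open>(1 - \<delta>\<^sup>2) (M - m)\<close>, whatever the value of \<open>A v\<close> at the base point \<open>z\<close>.
\<close>

lemma power_iteration_step:
  fixes A :: "('y::metric_space \<Rightarrow>\<^sub>C real) \<Rightarrow>\<^sub>L ('y \<Rightarrow>\<^sub>C real)" and u v :: "'y \<Rightarrow>\<^sub>C real"
  assumes ge: "\<And>f y. (\<And>y. 0 \<le> apply_bcontfun f y) \<Longrightarrow> 0 \<le> A f y"
    and harnack: "\<And>f x y. (\<And>y. 0 \<le> apply_bcontfun f y) \<Longrightarrow> \<delta> * A f y \<le> A f x" and \<delta>: "0 < \<delta>"
    and u: "u z = 1" "\<And>x. 0 \<le> apply_bcontfun u x"
    and m: "0 < m" "\<And>x. m * u x \<le> A u x" and M: "\<And>x. A u x \<le> M * u x"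
    and v: "v = (1 / A u z) *\<^sub>R A u"
  shows "v z = 1" "\<And>x. \<delta> \<le> v x" "\<And>x. \<delta> * v x \<le> 1" "m \<le> A v z"
    "\<And>x. (m + \<delta>\<^sup>2 * (A v z - m)) * v x \<le> A v x"
    "\<And>x. A v x \<le> (M - \<delta>\<^sup>2 * (M - A v z)) * v x"
proof -
  have r: "0 < A u z" using m(1) m(2)[of z] u(1) by simp
  show vz: "v z = 1" using r by (simp add: v)
  show low: "\<delta> \<le> v x" for x using harnack[of u z x] u r by (simp add: v field_simps)
  show up: "\<delta> * v x \<le> 1" for x using harnack[of u x z] u r by (simp add: v field_simps)
  have Av: "A v = (1 / A u z) *\<^sub>R A (A u)" by (simp add: v blinfun.scaleR_right)
  have lo: "\<delta> * (A v y - m * v y) \<le> A v x - m * v x" for x y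
  proof -
    have "\<delta> * A (A u - m *\<^sub>R u) y \<le> A (A u - m *\<^sub>R u) x" using m by (intro harnack) simp
    then have "\<delta> * (A (A u) y - m * A u y) / A u z \<le> (A (A u) x - m * A u x) / A u z"
      using r by (simp add: blinfun.diff_right blinfun.scaleR_right divide_right_mono)
    then show ?thesis unfolding Av by (simp add: v diff_divide_distrib algebra_simps)
  qed
  have hi: "\<delta> * (M * v y - A v y) \<le> M * v x - A v x" for x y
  proof -
    have "\<delta> * A (M *\<^sub>R u - A u) y \<le> A (M *\<^sub>R u - A u) x" using M by (intro harnack) simp
    then have "\<delta> * (M * A u y - A (A u) y) / A u z \<le> (M * A u x - A (A u) x) / A u z"
      using r by (simp add: blinfun.diff_right blinfun.scaleR_right divide_right_mono)
    then show ?thesis unfolding Av by (simp add: v diff_divide_distrib algebra_simps)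
  qed
  show mz: "m \<le> A v z"
    using ge[of "A u - m *\<^sub>R u" z] m r vz unfolding Av
    by (simp add: blinfun.diff_right blinfun.scaleR_right field_simps)
  have Mz: "A v z \<le> M"
    using ge[of "M *\<^sub>R u - A u" z] M r vz unfolding Av
    by (simp add: blinfun.diff_right blinfun.scaleR_right field_simps)
  show "(m + \<delta>\<^sup>2 * (A v z - m)) * v x \<le> A v x" for x
  proof -
    have "\<delta> * (A v z - m) * (\<delta> * v x) \<le> \<delta> * (A v z - m) * 1"
      using mz \<delta> up by (intro mult_left_mono) auto
    with lo[of z x] vz show ?thesis by (simp add: power2_eq_square algebra_simps)
  qed
  show "A v x \<le> (M - \<delta>\<^sup>2 * (M - A v z)) * v x" for x
  proof -
    have "\<delta> * (M - A v z) * (\<delta> * v x) \<le> \<delta> * (M - A v z) * 1"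
      using Mz \<delta> up by (intro mult_left_mono) auto
    with hi[of z x] vz show ?thesis by (simp add: power2_eq_square algebra_simps)
  qed
qed

text \<open>
  A Perron-Frobenius theorem in which the Harnack inequality takes the role of compactness: by the previous lemma the oscillation of
  \<open>A u\<^sub>n / u\<^sub>n\<close> decays geometrically, so the normalised iterates of \<open>1\<close> form a Cauchy sequence. The Harnack
  inequality also keeps them above \<open>\<delta>\<close>, hence the limit is positive.
\<close>

lemma harnack_eigenfunction:
  fixes A :: "('y::metric_space \<Rightarrow>\<^sub>C real) \<Rightarrow>\<^sub>L ('y \<Rightarrow>\<^sub>C real)"
  assumes K: "compact (UNIV :: 'y set)"
    and ge: "\<And>f y. (\<And>y. 0 \<le> apply_bcontfun f y) \<Longrightarrow> 0 \<le> A f y"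
    and harnack: "\<And>f x y. (\<And>y. 0 \<le> apply_bcontfun f y) \<Longrightarrow> \<delta> * A f y \<le> A f x" and \<delta>: "0 < \<delta>"
    and pos: "\<And>y. 0 < A (const_bcontfun 1) y"
  obtains \<kappa> \<psi> where "0 < \<kappa>" "\<And>y. 0 < apply_bcontfun \<psi> y" "A \<psi> = \<kappa> *\<^sub>R \<psi>"
proof -
  \<comment> \<open>The base point at which the iterates are normalised to \<open>1\<close>.\<close>
  fix z :: 'y
  let ?one = "const_bcontfun 1 :: 'y \<Rightarrow>\<^sub>C real"
  define u where "u = rec_nat ?one (\<lambda>_ u. (1 / A u z) *\<^sub>R A u)"
  have u: "u 0 = ?one" "u (Suc n) = (1 / A (u n) z) *\<^sub>R A (u n)" for n by (auto simp: u_def)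
  obtain m0 where m0: "0 < m0" "\<And>y. m0 \<le> A ?one y"
    using positive_bounded_below[OF K pos] by blast
  define W where "W = norm (A ?one) - m0"
  define q where "q = 1 - \<delta>\<^sup>2"
  have "\<delta> \<le> 1" using harnack[of ?one z z] pos[of z] by simp
  then have q: "0 \<le> q" "q < 1" using \<delta> by (auto simp: q_def power_le_one)
  have inv: "u n z = 1 \<and> (\<forall>x. 0 \<le> u n x) \<and> (\<forall>x. \<delta> \<le> u n x \<and> \<delta> * u n x \<le> 1) \<and>
      (\<exists>m M. m0 \<le> m \<and> M - m = q ^ n * W \<and> (\<forall>x. m * u n x \<le> A (u n) x \<and> A (u n) x \<le> M * u n x))" for n
  proof (induction n)
    case 0
    have "A ?one x \<le> norm (A ?one)" for x using abs_le_norm[of "A ?one" x] by simp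
    then have "\<exists>m M. m0 \<le> m \<and> M - m = q ^ 0 * W \<and> (\<forall>x. m * u 0 x \<le> A (u 0) x \<and> A (u 0) x \<le> M * u 0 x)"
      using m0 by (intro exI[of _ m0] exI[of _ "norm (A ?one)"]) (simp add: u W_def)
    then show ?case using \<open>\<delta> \<le> 1\<close> by (simp add: u)
  next
    case (Suc n)
    then obtain m M where mM: "m0 \<le> m" "M - m = q ^ n * W"
      "\<And>x. m * u n x \<le> A (u n) x" "\<And>x. A (u n) x \<le> M * u n x" by blast
    have m: "0 < m" using m0 mM by simp
    have un: "u n z = 1" "\<And>x. 0 \<le> u n x" using Suc by auto
    note step = power_iteration_step[OF _ _ \<delta> un m mM(3,4) u(2)]
    have s: "u (Suc n) z = 1" "\<And>x. \<delta> \<le> u (Suc n) x" "\<And>x. \<delta> * u (Suc n) x \<le> 1" "m \<le> A (u (Suc n)) z"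
      "\<And>x. (m + \<delta>\<^sup>2 * (A (u (Suc n)) z - m)) * u (Suc n) x \<le> A (u (Suc n)) x"
      "\<And>x. A (u (Suc n)) x \<le> (M - \<delta>\<^sup>2 * (M - A (u (Suc n)) z)) * u (Suc n) x"
      by (rule step, (rule ge, blast), (rule harnack, blast))+
    let ?m = "m + \<delta>\<^sup>2 * (A (u (Suc n)) z - m)" and ?M = "M - \<delta>\<^sup>2 * (M - A (u (Suc n)) z)"
    have "?M - ?m = q * (M - m)" by (simp add: q_def algebra_simps)
    then have "?M - ?m = q ^ Suc n * W" by (simp add: mM)
    moreover have "m0 \<le> ?m" using mM s(4) by (simp add: add_increasing2)
    ultimately have ex: "\<exists>m M. m0 \<le> m \<and> M - m = q ^ Suc n * W \<and>
        (\<forall>x. m * u (Suc n) x \<le> A (u (Suc n)) x \<and> A (u (Suc n)) x \<le> M * u (Suc n) x)"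
      using s(5,6) by blast
    have nonneg: "0 \<le> u (Suc n) x" for x using s(2)[of x] \<delta> by linarith
    show ?case by (intro conjI allI impI s(1-3) nonneg ex)
  qed
  have diff: "norm (u (Suc (Suc n)) - u (Suc n)) \<le> q ^ Suc n * (W / (\<delta> * m0))" for n
  proof (rule norm_leI)
    fix x
    obtain m M where mM: "m0 \<le> m" "M - m = q ^ Suc n * W"
      "\<And>x. m * u (Suc n) x \<le> A (u (Suc n)) x" "\<And>x. A (u (Suc n)) x \<le> M * u (Suc n) x" using inv[of "Suc n"] by blast
    have ux: "0 \<le> u (Suc n) x" "u (Suc n) x \<le> 1 / \<delta>" using inv[of "Suc n"] \<delta> by (auto simp: field_simps)
    have r: "m \<le> A (u (Suc n)) z" "A (u (Suc n)) z \<le> M"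
      using mM(3,4)[of z] inv[of "Suc n"] by auto
    let ?r = "A (u (Suc n)) z"
    have "\<bar>A (u (Suc n)) x - ?r * u (Suc n) x\<bar> \<le> (M - m) * u (Suc n) x"
      using mM(3,4)[of x] mult_right_mono[OF r(1) ux(1)] mult_right_mono[OF r(2) ux(1)]
      by (auto simp: abs_le_iff algebra_simps)
    also have "\<dots> \<le> (M - m) * (1 / \<delta>)" using r ux by (intro mult_left_mono) auto
    finally have "\<bar>A (u (Suc n)) x - ?r * u (Suc n) x\<bar> / ?r \<le> (M - m) * (1 / \<delta>) / m0"
      using m0 mM r \<delta> by (intro frac_le) auto
    moreover have "(u (Suc (Suc n)) - u (Suc n)) x = (A (u (Suc n)) x - ?r * u (Suc n) x) / ?r"
      using m0 mM(1) r by (simp add: u(2)[of "Suc n"] diff_divide_distrib)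
    moreover have "0 < ?r" using m0 mM(1) r by linarith
    ultimately show "\<bar>(u (Suc (Suc n)) - u (Suc n)) x\<bar> \<le> q ^ Suc n * (W / (\<delta> * m0))"
      by (simp only: abs_divide mM(2)) (simp add: field_simps)
  qed
  have "summable (\<lambda>n. q ^ Suc n * (W / (\<delta> * m0)))"
    using q by (intro summable_mult2) (simp add: summable_geometric summable_Suc_iff)
  then have "summable (\<lambda>n. u (Suc (Suc n)) - u (Suc n))"
    by (rule summable_comparison_test') (rule diff)
  then have "convergent (\<lambda>n. \<Sum>i<n. u (Suc (Suc i)) - u (Suc i))"
    by (simp add: summable_iff_convergent)
  then have "convergent (\<lambda>n. u (Suc n) - u (Suc 0))"
    using sum_lessThan_telescope[of "\<lambda>n. u (Suc n)"] by simp
  then have "convergent (\<lambda>n. u (Suc n))"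
    by (simp add: convergent_diff_const_right_iff)
  then obtain \<psi> where lim: "(\<lambda>n. u (Suc n)) \<longlonglongrightarrow> \<psi>" by (auto simp: convergent_def)
  have low: "\<delta> \<le> \<psi> y" for y
    by (rule LIMSEQ_le_const[OF tendsto_eval[OF lim]]) (use inv in auto)
  have Alim: "(\<lambda>n. A (u (Suc n))) \<longlonglongrightarrow> A \<psi>" by (intro tendsto_intros lim)
  have "(\<lambda>n. A (u (Suc n)) z *\<^sub>R u (Suc (Suc n))) \<longlonglongrightarrow> A \<psi> z *\<^sub>R \<psi>"
    by (intro tendsto_intros tendsto_eval[OF Alim] LIMSEQ_Suc[OF lim])
  moreover have "A (u (Suc n)) z *\<^sub>R u (Suc (Suc n)) = A (u (Suc n))" for n
  proof -
    obtain m where "m0 \<le> m" "m * u (Suc n) z \<le> A (u (Suc n)) z" using inv[of "Suc n"] by blast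
    then have "A (u (Suc n)) z \<noteq> 0" using inv[of "Suc n"] m0 by auto
    then show ?thesis by (simp add: u(2)[of "Suc n"])
  qed
  ultimately have eig: "A \<psi> = A \<psi> z *\<^sub>R \<psi>" using Alim LIMSEQ_unique by simp
  show ?thesis
  proof (rule that[OF _ _ eig])
    show "0 < apply_bcontfun \<psi> y" for y using low[of y] \<delta> by linarith
    have "\<delta> * A ?one z \<le> A \<psi> z"
      using ge[of "\<psi> - \<delta> *\<^sub>R ?one" z] low by (simp add: blinfun.diff_right blinfun.scaleR_right)
    then show "0 < A \<psi> z" using \<delta> pos[of z] by (smt (verit) mult_pos_pos)
  qed
qed

section \<open>Ground states of Schroedinger semigroups\<close>

text \<open>
  The smoothing assumption says that the Schroedinger semigroup maps into \<open>D\<close> at positive times; it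
  provides regularity of eigenfunctions and, letting \<open>t \<rightarrow> 0\<close>, density of the domain of the generator.
\<close>

locale smooth_schrodinger = markov P for P :: "'y::metric_space family" +
  fixes V :: "'y \<Rightarrow>\<^sub>C real" and Q :: "'y family" and D :: "('y \<Rightarrow>\<^sub>C real) set"
  assumes schrodinger: "is_schrodinger P V Q"
    and smoothing: "\<And>t f. 0 < t \<Longrightarrow> Q t f \<in> D"
    and subspace_D: "subspace D" and D_gen_dom: "D \<subseteq> gen_dom P"

sublocale smooth_schrodinger \<subseteq> Q: positive_semigroup Q
  using schrodinger compact_space by unfold_locales (auto simp: is_schrodinger_def)

context smooth_schrodinger
begin

lemma gen_dom_Q: "gen_dom Q = gen_dom P"
  and gen_Q: "f \<in> gen_dom P \<Longrightarrow> gen Q f = gen P f + mult_C V f"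
  using schrodinger by (auto simp: is_schrodinger_def)

text \<open>
  The path \<open>P (t - s) (Q s f)\<close> joins \<open>P t f\<close> to \<open>Q t f\<close>, and the unbounded part of the two generators
  cancels in its derivative.
\<close>

lemma has_vector_derivative_interpolation:
  assumes f: "f \<in> gen_dom P" and s: "s \<in> {0..t}"
  shows "((\<lambda>s. P (t - s) (Q s f)) has_vector_derivative P (t - s) (mult_C V (Q s f))) (at s within {0..t})"
  unfolding has_vector_derivative_iff_slope
proof -
  let ?h = "Q s f"
  have h: "?h \<in> gen_dom P" using Q.gen_dom_invariant(1)[of f s] f s by (simp add: gen_dom_Q)
  have "((\<lambda>r. Q r f) has_vector_derivative gen Q ?h) (at s within {0..t})"
    using Q.has_vector_derivative_orbit[of f s] Q.gen_dom_invariant(2)[of f s] f s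
    by (auto simp: gen_dom_Q intro: has_vector_derivative_within_subset)
  then have 1: "((\<lambda>r. P (t - r) ((1 / (r - s)) *\<^sub>R (Q r f - ?h))) \<longlongrightarrow> P (t - s) (gen Q ?h)) (at s within {0..t})"
    unfolding has_vector_derivative_iff_slope
    using s by (intro tendsto_joint) (auto simp: eventually_at_filter intro!: tendsto_intros)
  have "((\<lambda>u. P u ?h) has_vector_derivative P (t - s) (gen P ?h)) (at (t - s) within (\<lambda>r. t - r) ` {0..t})"
    by (rule has_vector_derivative_within_subset[OF has_vector_derivative_orbit[OF h]]) (use s in auto)
  then have "((\<lambda>u. P u ?h) \<circ> (\<lambda>r. t - r) has_vector_derivative (-1) *\<^sub>R P (t - s) (gen P ?h)) (at s within {0..t})"
    by (intro vector_diff_chain_within) (auto intro!: derivative_eq_intros)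
  then have 2: "((\<lambda>r. (1 / (r - s)) *\<^sub>R (P (t - r) ?h - P (t - s) ?h)) \<longlongrightarrow> - P (t - s) (gen P ?h)) (at s within {0..t})"
    by (simp add: has_vector_derivative_iff_slope)
  have "P (t - s) (gen Q ?h) + - P (t - s) (gen P ?h) = P (t - s) (mult_C V ?h)"
    by (simp add: gen_Q[OF h] blinfun.add_right)
  then show "((\<lambda>r. (1 / (r - s)) *\<^sub>R (P (t - r) (Q r f) - P (t - s) ?h)) \<longlongrightarrow> P (t - s) (mult_C V ?h)) (at s within {0..t})"
    using tendsto_add[OF 1 2]
    by (simp add: blinfun.diff_right blinfun.scaleR_right scaleR_diff_right)
qed

lemma interpolation_derivative:
  assumes f: "f \<in> gen_dom P" and s: "0 < s" "s < t"
  shows "((\<lambda>s. exp (a * s) * P (t - s) (Q s f) x) has_real_derivative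
      exp (a * s) * P (t - s) (mult_C V (Q s f) + a *\<^sub>R Q s f) x) (at s)"
proof -
  have "((\<lambda>s. P (t - s) (Q s f) x) has_real_derivative P (t - s) (mult_C V (Q s f)) x) (at s within {0..t})"
    unfolding has_real_derivative_iff_has_vector_derivative
    by (rule bounded_linear.has_vector_derivative[OF bounded_linear_eval has_vector_derivative_interpolation])
      (use assms in auto)
  then have "((\<lambda>s. P (t - s) (Q s f) x) has_real_derivative P (t - s) (mult_C V (Q s f)) x) (at s)"
    using s by (simp add: at_within_Icc_at)
  note this[derivative_intros]
  show ?thesis
    by (auto intro!: derivative_eq_intros simp: blinfun.add_right blinfun.scaleR_right algebra_simps)
qed

lemma interpolation_continuous:
  "continuous_on {0..t} (\<lambda>s. exp (a * s) * P (t - s) (Q s f) x)"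
proof -
  have "continuous_on {0..t} (\<lambda>s. P (t - s) (Q s f))"
    by (intro continuous_on_joint Q.continuous_on_joint continuous_intros) auto
  then have "continuous_on {0..t} (\<lambda>s. P (t - s) (Q s f) x)"
    by (auto simp: continuous_on_def intro: tendsto_eval)
  then show ?thesis by (intro continuous_intros)
qed

text \<open>
  Multiplied by \<open>exp (\<plusminus>\<parallel>V\<parallel> s)\<close>, the interpolating path is monotone in \<open>s\<close>, because \<open>V + \<parallel>V\<parallel> \<ge> 0\<close> and
  \<open>V - \<parallel>V\<parallel> \<le> 0\<close>. The general case follows by replacing \<open>f\<close> with \<open>Q r f\<close>, which lies in the domain,
  and letting \<open>r \<rightarrow> 0\<close>.
\<close>

lemma comparison:
  assumes f: "\<And>y. 0 \<le> apply_bcontfun f y" and t: "0 \<le> t"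
  shows "P t f x \<le> exp (norm V * t) * Q t f x" "Q t f x \<le> exp (norm V * t) * P t f x"
proof -
  let ?c = "norm V"
  have V: "0 \<le> V y * g + ?c * g" "V y * g + - ?c * g \<le> 0" if "0 \<le> g" for y g
    using mult_right_mono[OF _ that, of "- ?c" "V y"] mult_right_mono[OF _ that, of "V y" ?c] abs_le_norm[of V y]
    by (auto simp: abs_le_iff)
  have *: "P t g x \<le> exp (?c * t) * Q t g x \<and> Q t g x \<le> exp (?c * t) * P t g x"
    if g: "g \<in> gen_dom P" "\<And>y. 0 \<le> apply_bcontfun g y" for g
  proof
    have "exp (?c * 0) * P (t - 0) (Q 0 g) x \<le> exp (?c * t) * P (t - t) (Q t g) x"
    proof (rule DERIV_nonneg_imp_increasing_open[OF t])
      fix s assume s: "0 < s" "s < t"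
      have "0 \<le> exp (?c * s) * P (t - s) (mult_C V (Q s g) + ?c *\<^sub>R Q s g) x"
        using s V(1) by (auto intro!: mult_nonneg_nonneg nonneg simp: mult_C_apply compact_space Q.nonneg g)
      then show "\<exists>y. ((\<lambda>s. exp (?c * s) * P (t - s) (Q s g) x) has_real_derivative y) (at s) \<and> 0 \<le> y"
        using interpolation_derivative[OF g(1) s] by blast
    qed (rule interpolation_continuous)
    then show "P t g x \<le> exp (?c * t) * Q t g x" by simp
    have "exp (- ?c * t) * P (t - t) (Q t g) x \<le> exp (- ?c * 0) * P (t - 0) (Q 0 g) x"
    proof (rule DERIV_nonpos_imp_decreasing_open[OF t])
      fix s assume s: "0 < s" "s < t"
      have "P (t - s) (mult_C V (Q s g) + - ?c *\<^sub>R Q s g) x \<le> P (t - s) 0 x"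
        using s V(2) by (intro mono) (auto simp: mult_C_apply compact_space Q.nonneg g)
      then have "exp (- ?c * s) * P (t - s) (mult_C V (Q s g) + - ?c *\<^sub>R Q s g) x \<le> 0"
        by (simp add: mult_nonneg_nonpos)
      then show "\<exists>y. ((\<lambda>s. exp (- ?c * s) * P (t - s) (Q s g) x) has_real_derivative y) (at s) \<and> y \<le> 0"
        using interpolation_derivative[OF g(1) s, of "- ?c" x] by blast
    qed (rule interpolation_continuous)
    then show "Q t g x \<le> exp (?c * t) * P t g x" by (simp add: exp_minus field_simps)
  qed
  have lim: "((\<lambda>r. A (Q r f) x) \<longlongrightarrow> A f x) (at_right 0)" for A :: "('y \<Rightarrow>\<^sub>C real) \<Rightarrow>\<^sub>L ('y \<Rightarrow>\<^sub>C real)"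
    by (intro tendsto_eval tendsto_intros Q.tendsto_at_zero)
  have ev: "eventually (\<lambda>r. P t (Q r f) x \<le> exp (?c * t) * Q t (Q r f) x \<and>
      Q t (Q r f) x \<le> exp (?c * t) * P t (Q r f) x) (at_right 0)"
    unfolding eventually_at_filter using smoothing D_gen_dom
    by (auto intro!: always_eventually *[THEN conjunct1] *[THEN conjunct2] Q.nonneg f)
  show "P t f x \<le> exp (?c * t) * Q t f x"
    by (rule tendsto_le[OF _ tendsto_mult[OF tendsto_const lim] lim]) (use ev in \<open>auto elim: eventually_mono\<close>)
  show "Q t f x \<le> exp (?c * t) * P t f x"
    by (rule tendsto_le[OF _ tendsto_mult[OF tendsto_const lim] lim]) (use ev in \<open>auto elim: eventually_mono\<close>)
qed

lemma Q_one_pos: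
  assumes "0 \<le> t" shows "0 < Q t (const_bcontfun 1) y"
proof -
  have "1 \<le> exp (norm V * t) * Q t (const_bcontfun 1) y"
    using comparison(1)[of "const_bcontfun 1" t y] assms by (simp add: unit)
  then have "0 < exp (norm V * t) * Q t (const_bcontfun 1) y" by linarith
  then show ?thesis by (simp add: zero_less_mult_iff)
qed

text \<open>
  Condition (A) is a Harnack inequality for \<open>P\<close>, and the two-sided comparison transfers it to \<open>Q\<close>.
\<close>

lemma harnack:
  assumes "condition_A P"
  shows "\<exists>T>0. \<exists>\<delta>>0. \<forall>f x y. (\<forall>y. 0 \<le> apply_bcontfun f y) \<longrightarrow> \<delta> * Q T f y \<le> Q T f x"
proof -
  obtain T \<epsilon> where T: "0 < T" "0 < \<epsilon>" "\<And>x y f. \<epsilon> * P T (abs_C f) y \<le> P T (abs_C f) x"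
    using assms by (auto simp: condition_A_def)
  define E where "E = exp (norm V * T)"
  have E: "0 < E" by (simp add: E_def)
  have "\<epsilon> / (E * E) * Q T f y \<le> Q T f x" if f: "\<And>y. 0 \<le> apply_bcontfun f y" for f :: "'y \<Rightarrow>\<^sub>C real" and x y
  proof -
    have "abs_C f = f" using f by (intro bcontfun_eqI) (simp add: abs_C_apply compact_space)
    then have PT: "\<epsilon> * P T f y \<le> P T f x" using T(3)[of f y x] by simp
    have "\<epsilon> * Q T f y \<le> \<epsilon> * (E * P T f y)"
      using T comparison(2)[OF f, of T y] unfolding E_def by (intro mult_left_mono) auto
    also have "\<dots> = E * (\<epsilon> * P T f y)" by simp
    also have "\<dots> \<le> E * P T f x" using PT E by (intro mult_left_mono) auto
    also have "\<dots> \<le> E * (E * Q T f x)"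
      using T comparison(1)[OF f, of T x] E unfolding E_def by (intro mult_left_mono) auto
    finally show ?thesis using E by (simp add: field_simps)
  qed
  moreover have "0 < \<epsilon> / (E * E)" using T E by simp
  ultimately show ?thesis using T(1) by blast
qed

text \<open>
  The positive eigenfunction of the single operator \<open>Q T\<close> is unique up to a factor, again by the Harnack
  inequality. Since \<open>Q s\<close> commutes with \<open>Q T\<close>, the function \<open>\<psi>\<close> is an eigenfunction of every \<open>Q s\<close>. It lies
  in \<open>D\<close> by smoothing, so the generator acts on it, and does so by a scalar.
\<close>

lemma ground_state:
  assumes "condition_A P"
  obtains \<psi> l where "\<psi> \<in> D" "\<And>y. 0 < apply_bcontfun \<psi> y" "gen Q \<psi> = l *\<^sub>R \<psi>"
proof -
  fix z :: 'y
  obtain T \<delta> where T: "0 < T" "0 < \<delta>"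
    and H: "\<And>f x y. (\<And>y. 0 \<le> apply_bcontfun f y) \<Longrightarrow> \<delta> * Q T f y \<le> Q T f x"
    using harnack[OF assms] by meson
  have "\<And>f y. (\<And>y. 0 \<le> apply_bcontfun f y) \<Longrightarrow> 0 \<le> Q T f y" "\<And>y. 0 < Q T (const_bcontfun 1) y"
    using T by (auto intro: Q.nonneg Q_one_pos)
  with harnack_eigenfunction[OF compact_space _ H T(2)] obtain \<kappa> \<psi>
    where \<kappa>: "0 < \<kappa>" and pos: "\<And>y. 0 < apply_bcontfun \<psi> y" and eig: "Q T \<psi> = \<kappa> *\<^sub>R \<psi>"
    by metis
  have "\<psi> = (1 / \<kappa>) *\<^sub>R Q T \<psi>" using \<kappa> by (simp add: eig)
  then have D: "\<psi> \<in> D" using smoothing[OF T(1)] subspace_D subspace_scale by metis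
  define c where "c s = Q s \<psi> z / \<psi> z" for s
  have Qc: "Q s \<psi> = c s *\<^sub>R \<psi>" if s: "0 \<le> s" for s
  proof -
    let ?f = "Q s \<psi>"
    obtain x0 where x0: "\<And>y. div_C ?f \<psi> x0 \<le> div_C ?f \<psi> y"
      using attains_min[OF compact_space] by blast
    \<comment> \<open>The largest \<open>m\<close> with \<open>m \<psi> \<le> Q s \<psi>\<close>; the difference vanishes at \<open>x0\<close>, and a nonnegative eigenfunction with a zero is zero.\<close>
    define m where "m = ?f x0 / \<psi> x0"
    have p: "\<psi> y \<noteq> 0" for y using pos[of y] by simp
    have le: "m \<le> ?f y / \<psi> y" for y
      using x0[of y] by (simp add: div_C_apply[OF compact_space p] m_def)
    have ge: "0 \<le> apply_bcontfun (?f - m *\<^sub>R \<psi>) y" for y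
      using le[of y] pos[of y] by (simp add: pos_le_divide_eq)
    have A: "Q T (?f - m *\<^sub>R \<psi>) = \<kappa> *\<^sub>R (?f - m *\<^sub>R \<psi>)"
      using T s by (simp add: Q.commute[of T s] eig blinfun.diff_right blinfun.scaleR_right algebra_simps)
    have "(?f - m *\<^sub>R \<psi>) x0 = 0" using p[of x0] by (simp add: m_def)
    then have "\<delta> * (\<kappa> * (?f - m *\<^sub>R \<psi>) y) \<le> 0" for y
      using H[OF ge, of y x0] unfolding A by simp
    then have "(?f - m *\<^sub>R \<psi>) y = 0" for y
      using ge[of y] T \<kappa> by (smt (verit) mult_pos_pos)
    then have fm: "?f = m *\<^sub>R \<psi>" by (intro bcontfun_eqI) simp
    then show ?thesis using p by (simp add: c_def)
  qed
  have lim: "((\<lambda>s. (1 / s) *\<^sub>R (Q s \<psi> - \<psi>)) \<longlongrightarrow> gen Q \<psi>) (at_right 0)"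
    using D D_gen_dom by (intro gen_tendsto) (auto simp: gen_dom_Q)
  have eq: "((1 / s) *\<^sub>R (Q s \<psi> - \<psi>)) = ((c s - 1) / s) *\<^sub>R \<psi>" if "0 < s" for s
    using Qc[of s] that by (simp add: algebra_simps diff_divide_distrib)
  have "((\<lambda>s. ((1 / s) *\<^sub>R (Q s \<psi> - \<psi>)) z / \<psi> z) \<longlongrightarrow> gen Q \<psi> z / \<psi> z) (at_right 0)"
    using pos[of z] by (intro tendsto_intros tendsto_eval[OF lim]) simp
  moreover have "((1 / s) *\<^sub>R (Q s \<psi> - \<psi>)) z / \<psi> z = (c s - 1) / s" if "0 < s" for s
    using pos[of z] by (simp only: eq[OF that]) simp
  ultimately have "((\<lambda>s. (c s - 1) / s) \<longlongrightarrow> gen Q \<psi> z / \<psi> z) (at_right 0)"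
    by (elim tendsto_cong[THEN iffD1, rotated]) (rule eventually_mono[OF eventually_at_right_less])
  then have "((\<lambda>s. ((c s - 1) / s) *\<^sub>R \<psi>) \<longlongrightarrow> (gen Q \<psi> z / \<psi> z) *\<^sub>R \<psi>) (at_right 0)"
    by (rule tendsto_scaleR[OF _ tendsto_const])
  then have "((\<lambda>s. (1 / s) *\<^sub>R (Q s \<psi> - \<psi>)) \<longlongrightarrow> (gen Q \<psi> z / \<psi> z) *\<^sub>R \<psi>) (at_right 0)"
    by (rule tendsto_cong[THEN iffD1, rotated]) (auto simp: eventually_at_filter eq)
  then have "gen Q \<psi> = (gen Q \<psi> z / \<psi> z) *\<^sub>R \<psi>" by (rule gen_domI(2))
  from that[OF D pos this] show ?thesis .
qed

text \<open>
  The eigenvalue of a positive eigenfunction is the exponential growth rate of the norm, because \<open>1\<close> lies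
  between two positive multiples of \<open>\<psi>\<close>. This links the eigenvalue to the principal eigenvalue.
\<close>

lemma growth_rate:
  assumes "\<psi> \<in> gen_dom P" "\<And>y. 0 < apply_bcontfun \<psi> y" "gen Q \<psi> = l *\<^sub>R \<psi>"
  shows "((\<lambda>t. (1 / t) * ln (norm (Q t))) \<longlongrightarrow> l) at_top"
proof -
  have orbit: "Q t \<psi> y = exp (l * t) * \<psi> y" if "0 \<le> t" for t y
    by (rule Q.exponential_orbit[OF bounded_linear_eval _ that])
      (use assms in \<open>auto simp: gen_dom_Q blinfun.scaleR_right\<close>)
  obtain a where a: "0 < a" "\<And>y. a \<le> \<psi> y"
    using positive_bounded_below[OF compact_space assms(2)] by blast
  define b where "b = norm \<psi>"
  have b: "a \<le> b" "0 < b" using a(2)[of undefined] a(1) abs_le_norm[of \<psi> undefined] by (auto simp: b_def)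
  have lo: "exp (l * t) \<le> norm (Q t)" if "0 \<le> t" for t
  proof -
    have "Q t \<psi> = exp (l * t) *\<^sub>R \<psi>" by (rule bcontfun_eqI) (simp add: orbit that)
    then have "exp (l * t) * b \<le> norm (Q t) * b" using norm_blinfun[of "Q t" \<psi>] by (simp add: b_def)
    then show ?thesis using b by simp
  qed
  have up: "norm (Q t) \<le> exp (l * t) * (b / a)" if "0 \<le> t" for t
  proof -
    have "norm (Q t) \<le> norm (Q t (const_bcontfun 1))" by (rule Q.norm_le_norm_one[OF that])
    also have "\<dots> \<le> exp (l * t) * (b / a)"
    proof (rule norm_leI)
      fix y
      have "Q t (const_bcontfun 1) y \<le> Q t ((1 / a) *\<^sub>R \<psi>) y"
        by (rule Q.mono[OF that]) (use a in \<open>simp add: pos_le_divide_eq\<close>)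
      also have "\<dots> = exp (l * t) * (\<psi> y / a)" by (simp add: blinfun.scaleR_right orbit that)
      also have "\<dots> \<le> exp (l * t) * (b / a)"
        using a(1) abs_le_norm[of \<psi> y] by (intro mult_left_mono divide_right_mono) (auto simp: b_def)
      finally show "\<bar>Q t (const_bcontfun 1) y\<bar> \<le> exp (l * t) * (b / a)"
        using Q_one_pos[OF that, of y] by simp
    qed
    finally show ?thesis .
  qed
  have lower: "eventually (\<lambda>t. l \<le> (1 / t) * ln (norm (Q t))) at_top"
  proof (rule eventually_mono[OF eventually_gt_at_top[of 0]])
    fix t :: real assume t: "0 < t"
    then have "l * t \<le> ln (norm (Q t))" using lo[of t] by (metis exp_gt_zero less_imp_le less_le_trans ln_exp ln_mono)
    then show "l \<le> (1 / t) * ln (norm (Q t))" using t by (simp add: field_simps)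
  qed
  have upper: "eventually (\<lambda>t. (1 / t) * ln (norm (Q t)) \<le> l + ln (b / a) / t) at_top"
  proof (rule eventually_mono[OF eventually_gt_at_top[of 0]])
    fix t :: real assume t: "0 < t"
    have "0 < norm (Q t)" using lo[of t] t by (metis exp_gt_zero less_imp_le less_le_trans)
    then have "ln (norm (Q t)) \<le> ln (exp (l * t) * (b / a))" using up[of t] t by (intro ln_mono) auto
    also have "\<dots> = l * t + ln (b / a)" using a(1) b by (subst ln_mult) auto
    finally show "(1 / t) * ln (norm (Q t)) \<le> l + ln (b / a) / t" using t by (simp add: field_simps)
  qed
  have "((\<lambda>t. l + ln (b / a) / t) \<longlongrightarrow> l + 0) at_top"
    by (intro tendsto_intros tendsto_divide_0[OF tendsto_const] filterlim_at_top_imp_at_infinity filterlim_ident)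
  then show ?thesis
    by (intro tendsto_sandwich[OF lower upper tendsto_const]) simp
qed

end

section \<open>Equilibrium measures as minimisers\<close>

lemma integrable_bcontfun:
  assumes "\<mu> \<in> prob_measures"
  shows "integrable \<mu> (apply_bcontfun (f :: 'y::metric_space \<Rightarrow>\<^sub>C real))"
proof -
  interpret prob_space \<mu> using assms by (simp add: prob_measures_def)
  have "apply_bcontfun f \<in> borel_measurable \<mu>"
    using assms by (subst measurable_cong_sets[of \<mu> borel borel borel])
      (auto simp: prob_measures_def intro: borel_measurable_continuous_onI)
  then show ?thesis
    by (rule integrable_const_bound[of _ "norm f", rotated]) (simp add: abs_le_norm)
qed

lemma integrable_quotient:
  fixes f g :: "'y::metric_space \<Rightarrow>\<^sub>C real"
  assumes "compact (UNIV :: 'y set)" "\<mu> \<in> prob_measures" "\<And>y. g y \<noteq> 0"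
  shows "integrable \<mu> (\<lambda>y. f y / g y)"
proof -
  have "apply_bcontfun (div_C f g) = (\<lambda>y. f y / g y)"
    by (rule ext) (simp add: div_C_apply[OF assms(1,3)])
  then show ?thesis using integrable_bcontfun[OF assms(2), of "div_C f g"] by simp
qed

lemma bounded_linear_integral:
  assumes "\<mu> \<in> prob_measures"
  shows "bounded_linear (\<lambda>f :: 'y::metric_space \<Rightarrow>\<^sub>C real. \<integral>y. f y \<partial>\<mu>)"
proof (rule bounded_linear_intro[where K = 1])
  interpret prob_space \<mu> using assms by (simp add: prob_measures_def)
  fix f g :: "'y \<Rightarrow>\<^sub>C real" and r :: real
  note [simp] = integrable_bcontfun[OF assms]
  show "(\<integral>y. (f + g) y \<partial>\<mu>) = (\<integral>y. f y \<partial>\<mu>) + (\<integral>y. g y \<partial>\<mu>)"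
    by simp
  show "(\<integral>y. (r *\<^sub>R f) y \<partial>\<mu>) = r *\<^sub>R (\<integral>y. f y \<partial>\<mu>)"
    by simp
  have "norm (\<integral>y. f y \<partial>\<mu>) \<le> (\<integral>y. norm (f y) \<partial>\<mu>)" by (rule integral_norm_bound)
  also have "\<dots> \<le> (\<integral>y. norm f \<partial>\<mu>)"
    by (intro integral_mono) (auto simp: abs_le_norm)
  finally show "norm (\<integral>y. f y \<partial>\<mu>) \<le> norm f * 1" by (simp add: prob_space)
qed

lemma (in positive_semigroup) minimum_principle:
  assumes "f \<in> gen_dom Q" "\<And>y. 0 \<le> apply_bcontfun f y" "f x = 0"
  shows "0 \<le> gen Q f x"
proof (rule tendsto_lowerbound[OF tendsto_eval[OF gen_tendsto[OF assms(1)]]])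
  show "\<forall>\<^sub>F t in at_right 0. 0 \<le> ((1 / t) *\<^sub>R (Q t f - f)) x"
    using assms(2,3) by (auto simp: eventually_at_filter nonneg)
qed simp

lemma (in markov) const_in_gen_dom: "const_bcontfun 1 \<in> gen_dom P"
  and gen_const: "gen P (const_bcontfun 1) = 0"
proof -
  have "((\<lambda>t. (1 / t) *\<^sub>R (P t (const_bcontfun 1) - const_bcontfun 1)) \<longlongrightarrow> 0) (at_right 0)"
    by (rule tendsto_eventually) (auto simp: eventually_at_filter unit)
  then show "const_bcontfun 1 \<in> gen_dom P" "gen P (const_bcontfun 1) = 0" by (rule gen_domI)+
qed

text \<open>
  Both functions compared here arise by applying \<open>L\<close> and evaluating at \<open>x\<close>: to \<open>\<psi> (k - k(x))\<^sup>2\<close> for the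
  right-hand side and to \<open>(k - k(x))\<^sup>2\<close> for the carre du champ. Since \<open>\<psi> \<ge> a\<close>, the difference
  \<open>(\<psi> - a) (k - k(x))\<^sup>2\<close> is nonnegative and vanishes at \<open>x\<close>, and the minimum principle applies. This replaces
  the Leibniz rule, which fails for non-local generators.
\<close>

lemma (in markov) carre_du_champ_bounds:
  assumes k: "k \<in> gen_dom P" "mult_C k k \<in> gen_dom P"
    and \<psi>: "\<psi> \<in> gen_dom P" "mult_C k \<psi> \<in> gen_dom P" "mult_C k (mult_C k \<psi>) \<in> gen_dom P"
    and a: "0 \<le> a" "\<And>y. a \<le> apply_bcontfun \<psi> y"
  shows "0 \<le> carre_du_champ P k x"
    "a * carre_du_champ P k x
      \<le> gen P (mult_C k (mult_C k \<psi>)) x - 2 * k x * gen P (mult_C k \<psi>) x + (k x)\<^sup>2 * gen P \<psi> x"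
proof -
  define f where "f = 1 *\<^sub>R (1 *\<^sub>R mult_C k (mult_C k \<psi>) + (- 2 * k x) *\<^sub>R mult_C k \<psi>) + (k x)\<^sup>2 *\<^sub>R \<psi>"
  define g where "g = 1 *\<^sub>R (1 *\<^sub>R mult_C k k + (- 2 * k x) *\<^sub>R k) + (k x)\<^sup>2 *\<^sub>R const_bcontfun 1"
  note lin = gen_linear[of _ P]
  note M = mult_C_apply[OF compact_space]
  have f: "f \<in> gen_dom P"
    "gen P f x = gen P (mult_C k (mult_C k \<psi>)) x - 2 * k x * gen P (mult_C k \<psi>) x + (k x)\<^sup>2 * gen P \<psi> x"
    unfolding f_def by (simp_all only: lin \<psi>) simp_all
  have g: "g \<in> gen_dom P" "gen P g x = carre_du_champ P k x"
    unfolding g_def carre_du_champ_def by (simp_all only: lin k const_in_gen_dom gen_const) (simp_all add: M)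
  have fy: "f y = \<psi> y * (k y - k x)\<^sup>2" and gy: "g y = (k y - k x)\<^sup>2" for y
    by (simp_all add: f_def g_def M power2_eq_square algebra_simps)
  show "0 \<le> carre_du_champ P k x"
    using minimum_principle[OF g(1), of x] by (simp add: g(2) gy)
  have "0 \<le> gen P (1 *\<^sub>R f + (- a) *\<^sub>R g) x"
  proof (rule minimum_principle)
    show "1 *\<^sub>R f + (- a) *\<^sub>R g \<in> gen_dom P" by (intro lin f g)
    show "0 \<le> (1 *\<^sub>R f + (- a) *\<^sub>R g) y" for y
      using mult_right_mono[OF a(2)[of y], of "(k y - k x)\<^sup>2"] by (simp add: fy gy)
  qed (simp add: fy gy)
  then show "a * carre_du_champ P k x
      \<le> gen P (mult_C k (mult_C k \<psi>)) x - 2 * k x * gen P (mult_C k \<psi>) x + (k x)\<^sup>2 * gen P \<psi> x"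
    by (simp only: lin f g) (simp add: f g)
qed

text \<open>
  A ground state \<open>\<psi>\<close> together with a probability measure \<open>\<mu>\<close>, to be tested against the variational formula.
\<close>

locale ground_state_measure = smooth_schrodinger P V Q D
  for P :: "'y::metric_space family" and V Q D +
  fixes \<psi> :: "'y \<Rightarrow>\<^sub>C real" and l :: real and \<mu> :: "'y measure"
  assumes \<psi>_D: "\<psi> \<in> D" and \<psi>_pos: "\<And>y. 0 < \<psi> y" and eigen: "gen Q \<psi> = l *\<^sub>R \<psi>"
    and \<mu>: "\<mu> \<in> prob_measures"
begin

lemma \<psi>_gen_dom: "\<psi> \<in> gen_dom P" using \<psi>_D D_gen_dom by blast

lemma \<psi>_nonzero: "\<psi> y \<noteq> 0" using \<psi>_pos[of y] by simp

lemma gen_\<psi>: "gen P \<psi> y = (l - V y) * \<psi> y"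
proof -
  have "gen Q \<psi> y = gen P \<psi> y + V y * \<psi> y"
    by (simp add: gen_Q[OF \<psi>_gen_dom] mult_C_apply compact_space)
  then show ?thesis by (simp add: eigen algebra_simps)
qed

lemma integral_gen_\<psi>: "(\<integral>y. gen P \<psi> y / \<psi> y \<partial>\<mu>) = l - (\<integral>y. V y \<partial>\<mu>)"
proof -
  interpret prob_space \<mu> using \<mu> by (simp add: prob_measures_def)
  have "(\<integral>y. gen P \<psi> y / \<psi> y \<partial>\<mu>) = (\<integral>y. l - V y \<partial>\<mu>)"
    by (simp add: gen_\<psi> \<psi>_nonzero)
  also have "\<dots> = l - (\<integral>y. V y \<partial>\<mu>)"
    using integrable_bcontfun[OF \<mu>] by (simp add: prob_space)
  finally show ?thesis .
qed

text \<open>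
  The upper bound in the Donsker-Varadhan formula: the ground state is a test function in the definition of
  \<open>I(\<mu>)\<close>, and \<open>L \<psi> / \<psi> = l - V\<close>.
\<close>

lemma free_energy_le: "ereal (\<integral>y. V y \<partial>\<mu>) - rate_function P \<mu> \<le> ereal l"
proof -
  have "(INF u\<in>gen_dom_pos P. ereal (\<integral>y. gen P u y / u y \<partial>\<mu>)) \<le> ereal (l - (\<integral>y. V y \<partial>\<mu>))"
    by (rule INF_lower2[of \<psi>]) (simp_all add: gen_dom_pos_def \<psi>_gen_dom \<psi>_pos integral_gen_\<psi>)
  then show ?thesis
    unfolding rate_function_def
    by (cases "INF u\<in>gen_dom_pos P. ereal (\<integral>y. gen P u y / u y \<partial>\<mu>)") auto
qed

definition weight :: "'y \<Rightarrow>\<^sub>C real" where "weight = div_C (const_bcontfun 1) \<psi>"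

text \<open>
  The measure \<open>\<mu> / \<psi>\<close>, as a functional. For an equilibrium measure it is the left eigenvector of the
  Schroedinger semigroup.
\<close>

definition \<nu> :: "('y \<Rightarrow>\<^sub>C real) \<Rightarrow> real" where "\<nu> f = (\<integral>y. mult_C weight f y \<partial>\<mu>)"

lemma weight_apply: "mult_C weight f y = f y / \<psi> y"
  by (simp add: mult_C_apply compact_space weight_def div_C_apply \<psi>_nonzero)

lemma bounded_linear_\<nu>: "bounded_linear \<nu>"
  unfolding \<nu>_def
  by (rule bounded_linear_compose[OF bounded_linear_integral[OF \<mu>] bounded_linear_mult_C[OF compact_space]])

lemma \<nu>_mono: "(\<And>y. apply_bcontfun f y \<le> apply_bcontfun g y) \<Longrightarrow> \<nu> f \<le> \<nu> g"
  unfolding \<nu>_def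
  by (intro integral_mono integrable_bcontfun[OF \<mu>]) (simp add: weight_apply divide_right_mono \<psi>_pos less_imp_le)

end

locale ground_state_equilibrium = ground_state_measure +
  assumes equilibrium: "ereal l = ereal (\<integral>y. V y \<partial>\<mu>) - rate_function P \<mu>"
begin

text \<open>
  Equality in the variational formula means that \<open>u = \<psi>\<close> minimises \<open>\<integral> (L u / u) d\<mu>\<close>.
\<close>

lemma minimizer:
  assumes "u \<in> gen_dom_pos P"
  shows "l - (\<integral>y. V y \<partial>\<mu>) \<le> (\<integral>y. gen P u y / u y \<partial>\<mu>)"
proof -
  have "(INF u\<in>gen_dom_pos P. ereal (\<integral>y. gen P u y / u y \<partial>\<mu>)) \<le> ereal (\<integral>y. gen P u y / u y \<partial>\<mu>)"
    by (rule INF_lower) (rule assms)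
  with equilibrium show ?thesis
    unfolding rate_function_def
    by (cases "INF u\<in>gen_dom_pos P. ereal (\<integral>y. gen P u y / u y \<partial>\<mu>)") auto
qed

text \<open>
  The derivative of \<open>s \<mapsto> \<integral> (L u / u) d\<mu>\<close> at \<open>s = 0\<close> along \<open>u = \<psi> + s \<phi>\<close>. It is
  computed under the integral sign: with \<open>b = (L + V - l) \<phi>\<close> the identity \<open>L u / u = (l - V) + s b / u\<close> is exact, so minimality
  says \<open>\<integral> b / u d\<mu> \<ge> 0\<close> for small \<open>s > 0\<close>, and \<open>b / u\<close> tends to \<open>b / \<psi>\<close> uniformly.
\<close>

lemma first_variation_le:
  assumes \<phi>: "\<phi> \<in> gen_dom P"
  shows "0 \<le> \<nu> (gen Q \<phi> - l *\<^sub>R \<phi>)"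
proof -
  interpret prob_space \<mu> using \<mu> by (simp add: prob_measures_def)
  define b where "b = gen Q \<phi> - l *\<^sub>R \<phi>"
  obtain a where a: "0 < a" "\<And>y. a \<le> \<psi> y"
    using positive_bounded_below[OF compact_space \<psi>_pos] by blast
  \<comment> \<open>For \<open>s < s0\<close> the perturbed function stays above \<open>a / 2\<close>; the summand \<open>1\<close> avoids division by zero.\<close>
  define s0 where "s0 = a / (2 * (norm \<phi> + 1))"
  have s0: "0 < s0" using a by (simp add: s0_def add_nonneg_pos)
  define C where "C = norm b * norm \<phi> / (a * (a / 2))"
  have bound: "- (s * C) \<le> \<nu> b" if s: "0 < s" "s < s0" for s
  proof -
    define u where "u = 1 *\<^sub>R \<psi> + s *\<^sub>R \<phi>"
    have "s * norm \<phi> \<le> s0 * (norm \<phi> + 1)" using s by (intro mult_mono) auto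
    also have "\<dots> = a / 2" using norm_ge_zero[of \<phi>] by (simp add: s0_def field_simps add_nonneg_eq_0_iff)
    finally have s\<phi>: "s * norm \<phi> \<le> a / 2" .
    have u_low: "a / 2 \<le> u y" for y
    proof -
      have "s * \<bar>\<phi> y\<bar> \<le> a / 2" using s\<phi> mult_left_mono[OF abs_le_norm[of \<phi> y], of s] s by linarith
      then have "\<bar>s * \<phi> y\<bar> \<le> a / 2" using s by (simp add: abs_mult)
      then show ?thesis using a(2)[of y] by (simp add: u_def)
    qed
    then have u_pos: "0 < u y" for y using a(1) by (smt (verit) half_gt_zero)
    have u_nz: "u y \<noteq> 0" for y using u_pos[of y] by simp
    have u_dom: "u \<in> gen_dom P" unfolding u_def by (intro gen_linear \<psi>_gen_dom \<phi>)
    have quot: "gen P u y / u y = (l - V y) + s * (b y / u y)" for y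
    proof -
      have "gen P u y = gen P \<psi> y + s * gen P \<phi> y"
        unfolding u_def by (simp only: gen_linear \<psi>_gen_dom \<phi>) simp
      then have "gen P u y = (l - V y) * u y + s * b y"
        by (simp add: gen_\<psi> u_def b_def gen_Q[OF \<phi>] mult_C_apply compact_space algebra_simps)
      then show ?thesis using u_nz[of y] by (simp add: add_divide_distrib)
    qed
    have int_bu: "integrable \<mu> (\<lambda>y. b y / u y)"
      by (rule integrable_quotient[OF compact_space \<mu> u_nz])
    have int_b\<psi>: "integrable \<mu> (\<lambda>y. b y / \<psi> y)"
      by (rule integrable_quotient[OF compact_space \<mu> \<psi>_nonzero])
    have "l - (\<integral>y. V y \<partial>\<mu>) \<le> (\<integral>y. (l - V y) + s * (b y / u y) \<partial>\<mu>)"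
      using minimizer[of u] u_dom u_pos by (simp add: gen_dom_pos_def quot)
    also have "\<dots> = l - (\<integral>y. V y \<partial>\<mu>) + s * (\<integral>y. b y / u y \<partial>\<mu>)"
      using int_bu integrable_bcontfun[OF \<mu>, of V] by (simp add: prob_space del: times_divide_eq_right)
    finally have "0 \<le> s * (\<integral>y. b y / u y \<partial>\<mu>)" by simp
    then have "0 \<le> (\<integral>y. b y / u y \<partial>\<mu>)" using s by (simp add: zero_le_mult_iff)
    also have "\<dots> \<le> (\<integral>y. b y / \<psi> y + s * C \<partial>\<mu>)"
    proof (rule integral_mono)
      fix y
      have "b y / u y - b y / \<psi> y = - (s * (b y * \<phi> y) / (\<psi> y * u y))"
        using u_nz[of y] \<psi>_nonzero[of y] by (simp add: field_simps) (simp add: u_def algebra_simps)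
      also have "\<dots> \<le> \<bar>s * (b y * \<phi> y) / (\<psi> y * u y)\<bar>" by (rule abs_ge_minus_self)
      also have "\<dots> = s * (\<bar>b y\<bar> * \<bar>\<phi> y\<bar>) / (\<psi> y * u y)"
        using s u_pos[of y] \<psi>_pos[of y] by (simp add: abs_mult)
      also have "\<dots> \<le> s * (norm b * norm \<phi>) / (a * (a / 2))"
        using s a u_low[of y] less_imp_le[OF \<psi>_pos[of y]] by (intro frac_le mult_mono mult_left_mono mult_pos_pos abs_le_norm mult_nonneg_nonneg) auto
      finally show "b y / u y \<le> b y / \<psi> y + s * C" by (simp add: C_def)
    qed (use int_bu int_b\<psi> in auto)
    also have "\<dots> = \<nu> b + s * C" using int_b\<psi> by (simp add: \<nu>_def weight_apply prob_space)
    finally show ?thesis by simp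
  qed
  have "((\<lambda>s. - (s * C)) \<longlongrightarrow> - (0 * C)) (at_right 0)" by (intro tendsto_intros)
  moreover have "eventually (\<lambda>s. - (s * C) \<le> \<nu> b) (at_right 0)"
    using bound s0 by (auto simp: eventually_at_right_field)
  ultimately have "- (0 * C) \<le> \<nu> b" by (rule tendsto_upperbound) simp
  then show ?thesis by (simp add: b_def)
qed

lemma first_variation:
  assumes \<phi>: "\<phi> \<in> gen_dom P"
  shows "\<nu> (gen Q \<phi>) = l * \<nu> \<phi>"
proof -
  interpret \<nu>: bounded_linear \<nu> by (rule bounded_linear_\<nu>)
  have "- \<phi> \<in> gen_dom P" "gen Q (- \<phi>) = - gen Q \<phi>"
    using gen_linear[of \<phi> P \<phi> "-1" 0] gen_linear[of \<phi> Q \<phi> "-1" 0] \<phi> by (simp_all add: gen_dom_Q)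
  then show ?thesis
    using first_variation_le[OF \<phi>] first_variation_le[of "- \<phi>"] by (simp add: \<nu>.diff \<nu>.scaleR \<nu>.neg)
qed

lemma invariance:
  assumes "0 \<le> t" shows "\<nu> (Q t f) = exp (l * t) * \<nu> f"
proof -
  interpret \<nu>: bounded_linear \<nu> by (rule bounded_linear_\<nu>)
  have *: "\<nu> (Q t g) = exp (l * t) * \<nu> g" if g: "g \<in> gen_dom P" for g
  proof (rule Q.exponential_orbit[OF bounded_linear_\<nu> _ assms])
    show "\<nu> (Q s (gen Q g)) = l * \<nu> (Q s g)" if "0 \<le> s" for s
      using first_variation[of "Q s g"] Q.gen_dom_invariant[of g s] g that by (simp add: gen_dom_Q)
  qed (simp add: g gen_dom_Q)
  have ev: "eventually (\<lambda>r. \<nu> (Q t (Q r f)) = exp (l * t) * \<nu> (Q r f)) (at_right 0)"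
    using smoothing D_gen_dom by (auto simp: eventually_at_filter intro!: always_eventually *)
  have "((\<lambda>r. exp (l * t) * \<nu> (Q r f)) \<longlongrightarrow> exp (l * t) * \<nu> f) (at_right 0)"
    by (intro tendsto_intros \<nu>.tendsto Q.tendsto_at_zero)
  then have "((\<lambda>r. \<nu> (Q t (Q r f))) \<longlongrightarrow> exp (l * t) * \<nu> f) (at_right 0)"
    by (rule tendsto_cong[THEN iffD2, OF ev])
  moreover have "((\<lambda>r. \<nu> (Q t (Q r f))) \<longlongrightarrow> \<nu> (Q t f)) (at_right 0)"
    by (intro \<nu>.tendsto blinfun.tendsto tendsto_const Q.tendsto_at_zero)
  ultimately show ?thesis using tendsto_unique[OF trivial_limit_at_right_real] by blast
qed

text \<open>
  If \<open>f \<ge> 0\<close> is not zero, condition (B) and the comparison make \<open>Q T f\<close> strictly positive, and by invariance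
  \<open>\<nu> f\<close> is a positive multiple of \<open>\<nu> (Q T f)\<close>.
\<close>

lemma full_support:
  assumes B: "condition_B P" and f: "\<And>y. 0 \<le> apply_bcontfun f y" "f \<noteq> 0"
  shows "0 < \<nu> f"
proof -
  interpret prob_space \<mu> using \<mu> by (simp add: prob_measures_def)
  obtain T where T: "0 < T" "\<And>y. 0 < P T f y"
    using B f unfolding condition_B_def by blast
  have "0 < Q T f y" for y
  proof -
    have "0 < exp (norm V * T) * Q T f y"
      using comparison(1)[OF f(1), of T y] T(2)[of y] T(1) by simp
    then show ?thesis by (simp add: zero_less_mult_iff)
  qed
  then have "0 < mult_C weight (Q T f) y" for y
    using \<psi>_pos[of y] by (simp add: weight_apply)
  then obtain b where b: "0 < b" "\<And>y. b \<le> mult_C weight (Q T f) y"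
    using positive_bounded_below[OF compact_space] by blast
  have "b = (\<integral>y. b \<partial>\<mu>)" by (simp add: prob_space)
  also have "\<dots> \<le> \<nu> (Q T f)"
    unfolding \<nu>_def by (intro integral_mono integrable_bcontfun[OF \<mu>]) (use b in auto)
  finally have "0 < exp (l * T) * \<nu> f" using b(1) invariance[of T f] T(1) by simp
  then show ?thesis by (simp add: zero_less_mult_iff)
qed

end

text \<open>
  Put \<open>k = \<psi>1 / \<psi>2\<close>. The first variations at \<open>\<psi>1\<close> in the direction \<open>k \<psi>1\<close> and at \<open>\<psi>2\<close> in the direction
  \<open>\<psi>1\<close> are both zero, and their difference is the integral of
  \<open>G = L(k\<^sup>2 \<psi>2) - 2 k L(k \<psi>2) + k\<^sup>2 L \<psi>2\<close> against \<open>\<mu> / \<psi>1\<close>. As \<open>G\<close> dominates a positive multiple of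
  the carre du champ of \<open>k\<close>, full support forces the latter to vanish, and (D) makes \<open>k\<close> constant.
  Proportional ground states have the same quotient \<open>L \<psi> / \<psi> = l - V\<close>.
\<close>

lemma common_equilibrium_imp_potentials_differ_by_const:
  fixes P :: "'y::metric_space family"
  assumes 1: "ground_state_equilibrium P V1 Q1 D \<psi>1 l1 \<mu>"
    and 2: "ground_state_equilibrium P V2 Q2 D \<psi>2 l2 \<mu>"
    and B: "condition_B P" and C: "condition_C P D" and DD: "condition_D P D"
  shows "V1 y - V2 y = l1 - l2"
proof -
  interpret E1: ground_state_equilibrium P V1 Q1 D \<psi>1 l1 \<mu> by (rule 1)
  interpret E2: ground_state_equilibrium P V2 Q2 D \<psi>2 l2 \<mu> by (rule 2)
  interpret \<nu>: bounded_linear E1.\<nu> by (rule E1.bounded_linear_\<nu>)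
  note K = E1.compact_space
  define k where "k = div_C \<psi>1 \<psi>2"
  have k: "k y = \<psi>1 y / \<psi>2 y" for y
    by (simp add: k_def div_C_apply[OF K E2.\<psi>_nonzero])
  have kD: "k \<in> D" unfolding k_def using C E1.\<psi>_D E2.\<psi>_D E2.\<psi>_pos by (auto simp: condition_C_def)
  have multD: "mult_C f g \<in> D" if "f \<in> D" "g \<in> D" for f g using C that by (auto simp: condition_C_def)
  have k\<psi>2: "mult_C k \<psi>2 = \<psi>1"
    by (rule bcontfun_eqI) (simp add: mult_C_apply[OF K] k E2.\<psi>_nonzero)
  let ?\<phi> = "mult_C k \<psi>1"
  have dom: "f \<in> gen_dom P" if "f \<in> D" for f using that E1.D_gen_dom by blast
  have \<phi>D: "?\<phi> \<in> D" by (intro multD kD E1.\<psi>_D)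
  obtain a where a: "0 < a" "\<And>y. a \<le> \<psi>2 y"
    using positive_bounded_below[OF K E2.\<psi>_pos] by blast
  define G where "G = gen P ?\<phi> - 2 *\<^sub>R mult_C k (gen P \<psi>1) + mult_C k (mult_C k (gen P \<psi>2))"
  have \<Gamma>: "0 \<le> carre_du_champ P k x" "a * carre_du_champ P k x \<le> G x" for x
    using E1.carre_du_champ_bounds[of k \<psi>2 a x] a
      dom[OF kD] dom[OF multD[OF kD kD]] dom[OF E2.\<psi>_D] dom[OF E1.\<psi>_D] dom[OF \<phi>D]
    by (simp_all add: k\<psi>2 G_def mult_C_apply[OF K] power2_eq_square less_imp_le)
  have weights: "mult_C E2.weight h = mult_C E1.weight (mult_C k h)" for h
    by (rule bcontfun_eqI, simp only: E1.weight_apply E2.weight_apply)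
      (simp add: mult_C_apply[OF K] k E1.\<psi>_nonzero)
  have "E1.\<nu> G = 0"
  proof -
    have v1: "E1.\<nu> (gen Q1 ?\<phi> - l1 *\<^sub>R ?\<phi>) = 0"
      using E1.first_variation[OF dom[OF \<phi>D]] by (simp add: \<nu>.diff \<nu>.scaleR)
    interpret \<nu>2: bounded_linear E2.\<nu> by (rule E2.bounded_linear_\<nu>)
    have "0 = E2.\<nu> (gen Q2 \<psi>1 - l2 *\<^sub>R \<psi>1)"
      using E2.first_variation[OF E1.\<psi>_gen_dom] by (simp add: \<nu>2.diff \<nu>2.scaleR)
    also have "\<dots> = E1.\<nu> (mult_C k (gen Q2 \<psi>1 - l2 *\<^sub>R \<psi>1))"
      unfolding E1.\<nu>_def E2.\<nu>_def weights ..
    finally have v2: "E1.\<nu> (mult_C k (gen Q2 \<psi>1 - l2 *\<^sub>R \<psi>1)) = 0" by simp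
    have "G = (gen Q1 ?\<phi> - l1 *\<^sub>R ?\<phi>) - mult_C k (gen Q2 \<psi>1 - l2 *\<^sub>R \<psi>1)"
    proof (rule bcontfun_eqI)
      fix y
      have "k y * \<psi>2 y = \<psi>1 y" by (simp add: k E2.\<psi>_nonzero)
      then have "k y * (k y * gen P \<psi>2 y) = (l2 - V2 y) * (k y * \<psi>1 y)"
        by (simp add: E2.gen_\<psi>)
      then show "G y = ((gen Q1 ?\<phi> - l1 *\<^sub>R ?\<phi>) - mult_C k (gen Q2 \<psi>1 - l2 *\<^sub>R \<psi>1)) y"
        by (simp add: G_def mult_C_apply[OF K] E1.gen_Q[OF dom[OF \<phi>D]] E2.gen_Q[OF E1.\<psi>_gen_dom]
            E1.gen_\<psi> algebra_simps)
    qed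
    then show ?thesis by (simp only: \<nu>.diff[of "gen Q1 ?\<phi> - l1 *\<^sub>R ?\<phi>"] v1 v2)
  qed
  moreover have "E1.\<nu> (a *\<^sub>R carre_du_champ P k) \<le> E1.\<nu> G"
    by (rule E1.\<nu>_mono) (simp add: \<Gamma>)
  ultimately have "E1.\<nu> (carre_du_champ P k) \<le> 0"
    using a by (simp add: \<nu>.scaleR mult_le_0_iff)
  then have "carre_du_champ P k = 0"
    using E1.full_support[OF B \<Gamma>(1)] by (meson not_less)
  then obtain c where c: "\<And>y. k y = c" using DD kD unfolding condition_D_def by blast
  have \<psi>: "\<psi>1 y = c * \<psi>2 y" for y using c[of y] E2.\<psi>_nonzero[of y] by (simp add: k field_simps)
  then have "\<psi>1 = c *\<^sub>R \<psi>2 + 0 *\<^sub>R \<psi>2" by (intro bcontfun_eqI) simp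
  then have "gen P \<psi>1 = c *\<^sub>R gen P \<psi>2" using gen_linear(2)[of \<psi>2 P \<psi>2 c 0] E2.\<psi>_gen_dom by simp
  then have "gen P \<psi>1 y = c * gen P \<psi>2 y" by simp
  then have "(l1 - V1 y) * \<psi>1 y = (l2 - V2 y) * \<psi>1 y" by (simp add: E1.gen_\<psi> E2.gen_\<psi> \<psi>)
  then show ?thesis using E1.\<psi>_nonzero[of y] by simp
qed

lemma ground_state_exists:
  fixes P :: "'y::metric_space family"
  assumes K: "compact (UNIV :: 'y set)" and P: "markov_semigroup P"
    and A: "condition_A P" and C: "condition_C P D" and V: "smooth_potential P D V"
  shows "\<exists>\<psi>. \<forall>\<mu>\<in>prob_measures.
    ground_state_measure P V (schrodinger P V) D \<psi> (principal_eigenvalue P V) \<mu>"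
proof -
  interpret markov P
    using K P by unfold_locales (auto simp: markov_semigroup_def)
  interpret smooth_schrodinger P V "schrodinger P V" D
  proof
    show "is_schrodinger P V (schrodinger P V)" by (rule is_schrodinger)
    show "subspace D" "D \<subseteq> gen_dom P" using C by (auto simp: condition_C_def is_core_def)
    fix t :: real and f :: "'y \<Rightarrow>\<^sub>C real"
    assume "0 < t"
    then obtain p where p: "represents p (schrodinger P V t)"
      and smooth: "\<And>f. f \<in> bounded_borel \<Longrightarrow> \<exists>g\<in>D. \<forall>x. g x = (\<integral>y. f y \<partial>p x)"
      using V unfolding smooth_potential_def by blast
    have "apply_bcontfun f \<in> bounded_borel"
      by (auto simp: bounded_borel_def intro: borel_measurable_continuous_onI)
    then obtain g where g: "g \<in> D" "\<And>x. g x = (\<integral>y. f y \<partial>p x)" using smooth by blast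
    have "schrodinger P V t f = g"
      by (rule bcontfun_eqI) (use p g in \<open>simp add: represents_def\<close>)
    then show "schrodinger P V t f \<in> D" using g by simp
  qed
  obtain \<psi> l where \<psi>: "\<psi> \<in> D" "\<And>y. 0 < apply_bcontfun \<psi> y" "gen (schrodinger P V) \<psi> = l *\<^sub>R \<psi>"
    using ground_state[OF A] by blast
  have "((\<lambda>t. (1 / t) * ln (norm (schrodinger P V t))) \<longlongrightarrow> l) at_top"
    using \<psi> D_gen_dom by (intro growth_rate) auto
  then have "principal_eigenvalue P V = l"
    unfolding principal_eigenvalue_def by (intro tendsto_Lim) auto
  then have "ground_state_measure P V (schrodinger P V) D \<psi> (principal_eigenvalue P V) \<mu>"
    if "\<mu> \<in> prob_measures" for \<mu>
    using \<psi> that by unfold_locales auto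
  then show ?thesis by blast
qed

section \<open>Separable potentials and marginals\<close>

lemma compact_vec:
  assumes "compact (UNIV :: 'a::metric_space set)"
  shows "compact (UNIV :: ('a ^ 'n) set)"
proof -
  have "compact_space (euclidean :: 'a topology)"
    using assms by (simp add: compact_space_def)
  then have "compact (UNIV :: ('n \<Rightarrow> 'a) set)"
    using compact_space_product_topology[of "\<lambda>_::'n. euclidean :: 'a topology" UNIV]
    by (simp add: euclidean_product_topology compact_space_def)
  moreover have "continuous_on UNIV (\<lambda>f :: 'n \<Rightarrow> 'a. \<chi> i. f i)"
    by (intro continuous_on_vec_lambda continuous_on_product_coordinates)
  ultimately have "compact (range (\<lambda>f :: 'n \<Rightarrow> 'a. \<chi> i. f i))"
    by (rule compact_continuous_image[rotated])
  moreover have "x \<in> range (\<lambda>f :: 'n \<Rightarrow> 'a. \<chi> i. f i)" for x :: "'a ^ 'n"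
    by (rule range_eqI[of _ _ "vec_nth x"]) simp
  ultimately show ?thesis by (metis UNIV_eq_I)
qed

lemma separable_potential_apply:
  fixes v :: "'a::metric_space \<Rightarrow>\<^sub>C real" and x :: "'a ^ 'n"
  assumes "compact (UNIV :: 'a set)"
  shows "separable_potential v x = (\<Sum>i\<in>UNIV. v (x $ i)) / real CARD('n)"
  unfolding separable_potential_def
  by (subst apply_Bcontfun_compact[OF compact_vec[OF assms]])
    (auto intro!: continuous_intros continuous_on_compose2[OF continuous_on_apply_bcontfun])

text \<open>
  Symmetry under the transposition of the coordinates \<open>i\<close> and \<open>k\<close> shows that all terms of the average have
  the same integral. Thus the energy of a separable potential depends on the marginal only.
\<close>

lemma integral_separable_potential:
  fixes v :: "'a::metric_space \<Rightarrow>\<^sub>C real" and \<mu> :: "('a ^ 'n) measure"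
  assumes K: "compact (UNIV :: 'a set)" and \<mu>: "\<mu> \<in> prob_measures" and sym: "symmetric_measure \<mu>"
  shows "(\<integral>x. separable_potential v x \<partial>\<mu>) = (\<integral>x. v x \<partial>marginal k \<mu>)"
proof -
  interpret prob_space \<mu> using \<mu> by (simp add: prob_measures_def)
  have [measurable_cong, simp]: "sets \<mu> = sets borel" using \<mu> by (simp add: prob_measures_def)
  have borel: "f \<in> measurable \<mu> borel" if "continuous_on UNIV f" for f :: "'a ^ 'n \<Rightarrow> 'c::topological_space"
    using borel_measurable_continuous_onI[OF that] by (subst measurable_cong_sets[of \<mu> borel borel borel]) auto
  have v: "apply_bcontfun v \<in> borel_measurable borel" by (auto intro: borel_measurable_continuous_onI)
  have coord: "continuous_on UNIV (\<lambda>x :: 'a ^ 'n. v (x $ i))" for i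
    by (intro continuous_on_compose2[OF continuous_on_apply_bcontfun]) (auto intro: continuous_intros)
  have int: "integrable \<mu> (\<lambda>x. v (x $ i))" for i
    by (rule integrable_const_bound[of _ "norm v"]) (auto simp: abs_le_norm intro: borel coord)
  have exchange: "(\<integral>x. v (x $ i) \<partial>\<mu>) = (\<integral>x. v (x $ k) \<partial>\<mu>)" for i
  proof -
    define \<sigma> where "\<sigma> = Transposition.transpose i k"
    have "\<sigma> permutes UNIV" unfolding \<sigma>_def by (rule permutes_swap_id) auto
    then have "distr \<mu> borel (\<lambda>x. \<chi> j. x $ \<sigma> j) = \<mu>" using sym by (simp add: symmetric_measure_def)
    then have "(\<integral>x. v (x $ k) \<partial>\<mu>) = (\<integral>x. v (x $ k) \<partial>distr \<mu> borel (\<lambda>x. \<chi> j. x $ \<sigma> j))" by simp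
    also have "\<dots> = (\<integral>x. v ((\<chi> j. x $ \<sigma> j) $ k) \<partial>\<mu>)"
      by (intro integral_distr borel borel_measurable_continuous_onI coord)
        (auto intro!: continuous_intros)
    finally show ?thesis by (simp add: \<sigma>_def)
  qed
  have "(\<integral>x. separable_potential v x \<partial>\<mu>) = (\<Sum>i\<in>UNIV. \<integral>x. v (x $ i) \<partial>\<mu>) / real CARD('n)"
    using int by (simp add: separable_potential_apply[OF K] Bochner_Integration.integral_sum)
  also have "(\<Sum>i\<in>UNIV. \<integral>x. v (x $ i) \<partial>\<mu>) = (\<Sum>i\<in>(UNIV :: 'n set). \<integral>x. v (x $ k) \<partial>\<mu>)"
    by (intro sum.cong refl exchange)
  also have "\<dots> / real CARD('n) = (\<integral>x. v (x $ k) \<partial>\<mu>)" by simp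
  also have "\<dots> = (\<integral>x. v x \<partial>marginal k \<mu>)"
    unfolding marginal_def by (intro integral_distr[symmetric] borel v) (auto intro!: continuous_intros)
  finally show ?thesis .
qed

theorem theorem4:
  fixes P :: "('a::metric_space ^ 'n) family"
    and Dinf :: "(('a ^ 'n) \<Rightarrow>\<^sub>C real) set"
    and V0 :: "('a ^ 'n) \<Rightarrow>\<^sub>C real"
    and v1 v2 :: "'a \<Rightarrow>\<^sub>C real"
    and \<mu>1 \<mu>2 :: "('a ^ 'n) measure"
    and k :: 'n
  assumes "compact (UNIV :: 'a set)"
    and "markov_semigroup P"
    and "condition_A P" and "condition_B P" and "condition_C P Dinf" and "condition_D P Dinf"
    and "smooth_potential P Dinf (V0 + separable_potential v1)"
    and "smooth_potential P Dinf (V0 + separable_potential v2)"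
    and "equilibrium_measure P (V0 + separable_potential v1) \<mu>1" and "symmetric_measure \<mu>1"
    and "equilibrium_measure P (V0 + separable_potential v2) \<mu>2" and "symmetric_measure \<mu>2"
    and "marginal k \<mu>1 = marginal k \<mu>2"
  shows "\<exists>c. \<forall>x. v1 x - v2 x = c"
proof -
  let ?V1 = "V0 + separable_potential v1" and ?V2 = "V0 + separable_potential v2"
  let ?l1 = "principal_eigenvalue P ?V1" and ?l2 = "principal_eigenvalue P ?V2"
  have K: "compact (UNIV :: ('a ^ 'n) set)" by (rule compact_vec) (rule assms(1))
  have \<mu>: "\<mu>1 \<in> prob_measures" "\<mu>2 \<in> prob_measures"
    using assms(9,11) by (auto simp: equilibrium_measure_def)
  obtain \<psi>1 where 1: "\<And>\<mu>. \<mu> \<in> prob_measures \<Longrightarrow> ground_state_measure P ?V1 (schrodinger P ?V1) Dinf \<psi>1 ?l1 \<mu>"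
    using ground_state_exists[OF K assms(2,3,5,7)] by blast
  obtain \<psi>2 where 2: "\<And>\<mu>. \<mu> \<in> prob_measures \<Longrightarrow> ground_state_measure P ?V2 (schrodinger P ?V2) Dinf \<psi>2 ?l2 \<mu>"
    using ground_state_exists[OF K assms(2,3,5,8)] by blast
  have int: "(\<integral>x. (V0 + separable_potential v) x \<partial>\<mu>) = (\<integral>x. V0 x \<partial>\<mu>) + (\<integral>x. v x \<partial>marginal k \<mu>)"
    if "\<mu> \<in> prob_measures" "symmetric_measure \<mu>" for v and \<mu> :: "('a ^ 'n) measure"
    using integrable_bcontfun[OF that(1)]
    by (simp add: integral_separable_potential[OF assms(1) that])
  note int = int[OF \<mu>(1) assms(10)] int[OF \<mu>(2) assms(12)]
  have e1: "ereal ?l1 = ereal (\<integral>x. ?V1 x \<partial>\<mu>1) - rate_function P \<mu>1"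
    and e2: "ereal ?l2 = ereal (\<integral>x. ?V2 x \<partial>\<mu>2) - rate_function P \<mu>2"
    using assms(9,11) by (auto simp: equilibrium_measure_def)
  have le1: "ereal (\<integral>x. ?V1 x \<partial>\<mu>2) - rate_function P \<mu>2 \<le> ereal ?l1"
    by (rule ground_state_measure.free_energy_le[OF 1[OF \<mu>(2)]])
  have le2: "ereal (\<integral>x. ?V2 x \<partial>\<mu>1) - rate_function P \<mu>1 \<le> ereal ?l2"
    by (rule ground_state_measure.free_energy_le[OF 2[OF \<mu>(1)]])
  obtain I1 where I1: "rate_function P \<mu>1 = ereal I1" using e1 by (cases "rate_function P \<mu>1") auto
  obtain I2 where I2: "rate_function P \<mu>2 = ereal I2" using e2 by (cases "rate_function P \<mu>2") auto
  \<comment> \<open>The Hohenberg-Kohn exchange: with equal marginals the two upper bounds add up to an equality, so \<open>\<mu>2\<close> is an equilibrium measure for both potentials.\<close>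
  have "ereal ?l1 = ereal (\<integral>x. ?V1 x \<partial>\<mu>2) - rate_function P \<mu>2"
    using e1 e2 le1 le2 unfolding I1 I2 int assms(13) by simp
  then have "ground_state_equilibrium P ?V1 (schrodinger P ?V1) Dinf \<psi>1 ?l1 \<mu>2"
    using 1[OF \<mu>(2)] by (simp add: ground_state_equilibrium_def ground_state_equilibrium_axioms_def)
  moreover have "ground_state_equilibrium P ?V2 (schrodinger P ?V2) Dinf \<psi>2 ?l2 \<mu>2"
    using 2[OF \<mu>(2)] e2 by (simp add: ground_state_equilibrium_def ground_state_equilibrium_axioms_def)
  ultimately have diff: "?V1 y - ?V2 y = ?l1 - ?l2" for y
    by (rule common_equilibrium_imp_potentials_differ_by_const) (rule assms)+
  \<comment> \<open>On the diagonal a separable potential takes the value of its one-particle function.\<close>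
  have "v1 x - v2 x = ?l1 - ?l2" for x
    using diff[of "\<chi> i. x"] by (simp add: separable_potential_apply[OF assms(1)])
  then show ?thesis by blast
qed

end
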